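(* There is a universal constant $C>0$ such that the following holds. For each $n\ge1$, let $z\in\{\pm1\}^n$ be a fixed vector, let $\lambda=\lambda_n\ge Cn^{1/3}$, let $\sigma=\sqrt n/\lambda$ (so that $\lambda\ge Cn^{1/3}$ is equivalent to $\sigma\le\frac1Cn^{1/6}$), and let $Y=zz^T+\sigma W$, where $W\in\mathbb{R}^{n\times n}$ is a random symmetric matrix with $W_{ii}=0$ for all $i$ and with entries $W_{ij}$, $i>j$, i.i.d. $\mathcal{N}(0,1)$. Then, with high probability, every second-order critical point $Q\in\mathbb{R}^{n\times2}$ of the problem $$\max_{Q\in\mathbb{R}^{n\times 2}} \operatorname{Tr}(Q^TYQ)\quad\text{s.t. } \|Q_{i:}\|_2^2=1,\ 1\le i\le n,$$ is a global optimum of this problem and satisfies $QQ^T=zz^T$.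
   Context: $Q_{i:}$ denotes the $i$th row of $Q$. "With high probability" means with probability tending to $1$ as $n\to\infty$. The operator $\mathrm{ddiag}$ maps a square matrix to the diagonal matrix obtained by setting all off-diagonal entries to zero; $\circ$ is the entrywise (Hadamard) product. For a symmetric cost matrix $A\in\mathbb{R}^{n\times n}$, a second-order critical point of $\max\{\operatorname{Tr}(Q^TAQ): Q\in\mathbb{R}^{n\times 2},\ \|Q_{i:}\|_2=1\ \forall i\}$ is a feasible $Q$ satisfying the first-order condition $(\mathrm{ddiag}(AQQ^T)-A)Q=0$ and the second-order condition $\mathrm{ddiag}(AQQ^T)-A\circ(QQ^T)\succeq 0$. *)

theory Defs
  imports "HOL-Probability.Probability" "Jordan_Normal_Form.Matrix"
begin

no_notation inner (infix "\<bullet>" 70)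
no_notation Finite_Cartesian_Product.vec_nth (infixl "$" 90)
hide_type (open) Finite_Cartesian_Product.vec
hide_const (open) Finite_Cartesian_Product.vec Finite_Cartesian_Product.mat
  Finite_Cartesian_Product.row Finite_Cartesian_Product.vec_nth Determinants.trace

section \<open>The rank-two optimization problem\<close>

definition trace :: "real mat \<Rightarrow> real" where
  "trace A = (\<Sum>i<dim_row A. A $$ (i, i))"

definition ddiag :: "real mat \<Rightarrow> real mat" where
  "ddiag A = mat (dim_row A) (dim_col A) (\<lambda>(i, j). if i = j then A $$ (i, j) else 0)"

definition hadamard :: "real mat \<Rightarrow> real mat \<Rightarrow> real mat" (infixl "\<odot>" 70) where
  "A \<odot> B = mat (dim_row A) (dim_col A) (\<lambda>(i, j). A $$ (i, j) * B $$ (i, j))"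

definition outer :: "real vec \<Rightarrow> real mat" where
  "outer v = mat (dim_vec v) (dim_vec v) (\<lambda>(i, j). v $ i * v $ j)"

definition psd :: "real mat \<Rightarrow> bool" where
  "psd S \<longleftrightarrow> S\<^sup>T = S \<and> (\<forall>v \<in> carrier_vec (dim_row S). v \<bullet> (S *\<^sub>v v) \<ge> 0)"

definition feasible :: "nat \<Rightarrow> real mat \<Rightarrow> bool" where
  "feasible n Q \<longleftrightarrow> Q \<in> carrier_mat n 2 \<and> (\<forall>i<n. row Q i \<bullet> row Q i = 1)"

definition objective :: "real mat \<Rightarrow> real mat \<Rightarrow> real" where
  "objective A Q = trace (Q\<^sup>T * A * Q)"

definition global_optimum :: "nat \<Rightarrow> real mat \<Rightarrow> real mat \<Rightarrow> bool" where
  "global_optimum n A Q \<longleftrightarrow>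
     feasible n Q \<and> (\<forall>Q'. feasible n Q' \<longrightarrow> objective A Q' \<le> objective A Q)"

definition second_order_critical :: "nat \<Rightarrow> real mat \<Rightarrow> real mat \<Rightarrow> bool" where
  "second_order_critical n A Q \<longleftrightarrow>
     feasible n Q \<and>
     (ddiag (A * Q * Q\<^sup>T) - A) * Q = 0\<^sub>m n 2 \<and>
     psd (ddiag (A * Q * Q\<^sup>T) - A \<odot> (Q * Q\<^sup>T))"

section \<open>The Gaussian noise\<close>

abbreviation std_normal :: "real measure" where
  "std_normal \<equiv> density lborel std_normal_density"

definition below_diag :: "nat \<Rightarrow> (nat \<times> nat) set" where
  "below_diag n = {(i, j). j < i \<and> i < n}"

text \<open>
  The random matrix is realized on its canonical probability space: a sample point \<open>w\<close> lists the
  entries below the diagonal, which are independent standard normal coordinates. Probabilities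
  concerning the matrix depend only on its law, and by \<open>wigner_law_unique\<close> below every random
  symmetric matrix with zero diagonal and i.i.d. standard normal entries below it, on whatever
  probability space, has this law.
\<close>

definition wigner_space :: "nat \<Rightarrow> (nat \<times> nat \<Rightarrow> real) measure" where
  "wigner_space n = (\<Pi>\<^sub>M p \<in> below_diag n. std_normal)"

definition wigner :: "nat \<Rightarrow> (nat \<times> nat \<Rightarrow> real) \<Rightarrow> real mat" where
  "wigner n w = mat n n (\<lambda>(i, j). if j < i then w (i, j) else if i < j then w (j, i) else 0)"

definition observation :: "real vec \<Rightarrow> real \<Rightarrow> real mat \<Rightarrow> real mat" where
  "observation z \<sigma> W = outer z + \<sigma> \<cdot>\<^sub>m W"

lemma prob_space_std_normal: "prob_space std_normal"
  using prob_space_normal_density[of 1 0] by simp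

lemma finite_below_diag: "finite (below_diag n)"
  by (rule finite_subset[of _ "{..<n} \<times> {..<n}"]) (auto simp: below_diag_def)

lemma prob_space_wigner_space: "prob_space (wigner_space n)"
  unfolding wigner_space_def by (intro prob_space_PiM prob_space_std_normal)

lemma wigner_symmetric: "(wigner n w)\<^sup>T = wigner n w"
  by (rule eq_matI) (auto simp: wigner_def)

theorem wigner_law_unique:
  fixes M :: "'a measure" and W :: "'a \<Rightarrow> real mat"
  assumes M: "prob_space M"
    and dim: "\<And>\<omega>. \<omega> \<in> space M \<Longrightarrow> W \<omega> \<in> carrier_mat n n"
    and sym: "\<And>\<omega>. \<omega> \<in> space M \<Longrightarrow> (W \<omega>)\<^sup>T = W \<omega>"
    and diag: "\<And>\<omega> i. \<omega> \<in> space M \<Longrightarrow> i < n \<Longrightarrow> W \<omega> $$ (i, i) = 0"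
    and indep: "prob_space.indep_vars M (\<lambda>_. borel) (\<lambda>p \<omega>. W \<omega> $$ p) (below_diag n)"
    and normal: "\<And>p. p \<in> below_diag n \<Longrightarrow>
      distributed M lborel (\<lambda>\<omega>. W \<omega> $$ p) std_normal_density"
  shows "distr M (wigner_space n) (\<lambda>\<omega>. \<lambda>p\<in>below_diag n. W \<omega> $$ p) = wigner_space n"
    and "\<And>\<omega>. \<omega> \<in> space M \<Longrightarrow> wigner n (\<lambda>p\<in>below_diag n. W \<omega> $$ p) = W \<omega>"
proof -
  interpret prob_space M by fact
  let ?X = "\<lambda>\<omega>. \<lambda>p\<in>below_diag n. W \<omega> $$ p"
  have rv: "random_variable borel (\<lambda>\<omega>. W \<omega> $$ p)" if "p \<in> below_diag n" for p
    using distributed_measurable[OF normal[OF that]] by simp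
  have law: "distr M borel (\<lambda>\<omega>. W \<omega> $$ p) = std_normal" if "p \<in> below_diag n" for p
    using distributed_distr_eq_density[OF normal[OF that]]
    by (metis (mono_tags, lifting) distr_cong sets_lborel)
  have sets_eq: "sets (wigner_space n) = sets (\<Pi>\<^sub>M p \<in> below_diag n. (borel :: real measure))"
    unfolding wigner_space_def by (rule sets_PiM_cong) auto
  have "distr M (wigner_space n) ?X = distr M (\<Pi>\<^sub>M p \<in> below_diag n. borel) ?X"
    by (rule distr_cong[OF refl sets_eq]) simp
  also have "\<dots> = (\<Pi>\<^sub>M p \<in> below_diag n. distr M borel (\<lambda>\<omega>. W \<omega> $$ p))"
  proof (cases "below_diag n = {}")
    case False
    then show ?thesis
      using indep_vars_iff_distr_eq_PiM'[of "below_diag n" "\<lambda>p \<omega>. W \<omega> $$ p" "\<lambda>_. borel"] rv indep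
      by blast
  next
    case True
    interpret D: prob_space "distr M (\<Pi>\<^sub>M p \<in> below_diag n. (borel :: real measure)) ?X"
      by (rule prob_space_distr) (rule measurable_restrict, rule rv)
    show ?thesis
      using D.emeasure_space_1
      by (auto intro!: measure_eqI simp: True PiM_empty sets_PiM_empty subset_singleton_iff)
  qed
  also have "\<dots> = wigner_space n"
    unfolding wigner_space_def by (rule PiM_cong) (auto simp: law)
  finally show "distr M (wigner_space n) ?X = wigner_space n" .
next
  fix \<omega> assume \<omega>: "\<omega> \<in> space M"
  have "W \<omega> $$ (i, j) = W \<omega> $$ (j, i)" if "i < n" "j < n" for i j
    using dim[OF \<omega>] sym[OF \<omega>] that by (metis carrier_matD index_transpose_mat(1))
  then show "wigner n (\<lambda>p\<in>below_diag n. W \<omega> $$ p) = W \<omega>"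
    using dim[OF \<omega>] diag[OF \<omega>]
    by (intro eq_matI) (auto simp: wigner_def below_diag_def not_less)
qed

end

theory Submission
  imports Defs "HOL-Real_Asymp.Real_Asymp"
begin

text \<open>
  After conjugation by \<open>z\<close> the data matrix has entries \<open>1 + s w\<^sub>i\<^sub>j\<close>. Testing the second-order condition
  with the two columns of \<open>Q\<close> shows that the sum of the rows of \<open>Q\<close> has norm \<open>r \<ge> n / 2\<close>. Rotate so that
  this sum is \<open>(r, 0)\<close> and write the rows as \<open>(p\<^sub>i, q\<^sub>i)\<close>. The first-order condition becomes
  \<open>l\<^sub>i p\<^sub>i = r + s (W p)\<^sub>i\<close> and \<open>l\<^sub>i q\<^sub>i = s (W q)\<^sub>i\<close> with \<open>l\<^sub>i \<ge> 0\<close>, so the rows are normalized perturbations of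
  \<open>(r, 0)\<close>, and \<open>p\<close> is close to the all-ones vector in Euclidean norm. Hence \<open>W p\<close> is uniformly small, all
  \<open>l\<^sub>i\<close> are of order \<open>n\<close>, and \<open>l q = s W q\<close> forces \<open>q = 0\<close> because \<open>s\<close> times the operator norm of \<open>W\<close> is
  below \<open>n / 8\<close>. This only needs \<open>\<parallel>W\<parallel>\<close> slightly below \<open>n\<close> to the power \<open>7/12\<close>, which leaves room for a
  union bound over a crude grid. Global optimality is certified by the dual matrix of \<open>z z\<^sup>T\<close>.
\<close>

section \<open>Critical points under deterministic noise bounds\<close>

text \<open>For \<open>K\<close> >= 0 this says that the operator norm of the n by n matrix
  \<open>w\<close> is at most \<open>K\<close>. The bilinear form is used so that both arguments can
  be rounded to a grid independently.\<close>

definition op_bound :: "nat \<Rightarrow> (nat \<Rightarrow> nat \<Rightarrow> real) \<Rightarrow> real \<Rightarrow> bool" where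
  "op_bound n w K \<longleftrightarrow> (\<forall>x y. (\<Sum>i<n. \<Sum>j<n. w i j * x i * y j) \<le> K * L2_set x {..<n} * L2_set y {..<n})"

lemma L2_set_power2: "(L2_set x A)\<^sup>2 = (\<Sum>i\<in>A. (x i)\<^sup>2)"
  by (simp add: L2_set_def sum_nonneg)

text \<open>Testing the bilinear form with the pair (W x, x) gives U^2 <= K U |x| for U = |W x|, and
  one factor U cancels.\<close>

lemma op_bound_mult:
  assumes "op_bound n w K" "0 \<le> K"
  shows "L2_set (\<lambda>i. \<Sum>j<n. w i j * x j) {..<n} \<le> K * L2_set x {..<n}"
proof -
  let ?u = "\<lambda>i. \<Sum>j<n. w i j * x j"
  let ?U = "L2_set ?u {..<n}"
  have "?U\<^sup>2 = (\<Sum>i<n. \<Sum>j<n. w i j * ?u i * x j)"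
    unfolding L2_set_power2
    by (intro sum.cong refl) (subst power2_eq_square, simp add: sum_distrib_left mult_ac)
  also have "\<dots> \<le> K * ?U * L2_set x {..<n}"
    using assms(1)[unfolded op_bound_def, THEN spec, THEN spec] .
  finally have *: "?U * ?U \<le> ?U * (K * L2_set x {..<n})"
    by (simp add: power2_eq_square mult_ac)
  show ?thesis
  proof (cases "?U = 0")
    case True
    then show ?thesis using assms(2) by simp
  next
    case False
    then have "?U > 0" by (simp add: order_less_le)
    with * show ?thesis by (simp add: mult_le_cancel_left_pos)
  qed
qed

lemma op_bound_mult_power2:
  assumes "op_bound n w K" "0 \<le> K"
  shows "(\<Sum>i<n. (\<Sum>j<n. w i j * x j)\<^sup>2) \<le> K\<^sup>2 * (\<Sum>i<n. (x i)\<^sup>2)"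
  using power_mono[OF op_bound_mult[OF assms, of x], of 2]
  by (simp add: power_mult_distrib L2_set_power2)

lemma op_bound_quadratic:
  assumes "op_bound n w K"
  shows "\<bar>\<Sum>i<n. \<Sum>j<n. w i j * x i * x j\<bar> \<le> K * (\<Sum>i<n. (x i)\<^sup>2)"
proof -
  have "(\<Sum>i<n. \<Sum>j<n. w i j * x i * x j) \<le> K * L2_set x {..<n} * L2_set x {..<n}"
    using assms unfolding op_bound_def by blast
  moreover have "(\<Sum>i<n. \<Sum>j<n. w i j * (- x i) * x j) \<le> K * L2_set (\<lambda>i. - x i) {..<n} * L2_set x {..<n}"
    using assms[unfolded op_bound_def, THEN spec, THEN spec] .
  moreover have "L2_set (\<lambda>i. - x i) {..<n} = L2_set x {..<n}"
    by (simp add: L2_set_def)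
  moreover have "K * L2_set x {..<n} * L2_set x {..<n} = K * (\<Sum>i<n. (x i)\<^sup>2)"
    unfolding L2_set_power2[symmetric] by (simp only: power2_eq_square mult.assoc)
  ultimately show ?thesis
    by (simp add: sum_negf)
qed

section \<open>Critical points: correlation with the signal, alignment, rigidity\<close>

lemma sum_product_lessThan: "(\<Sum>i<n. \<Sum>j<n. x i * y j) = (\<Sum>i<(n::nat). x i) * (\<Sum>j<n. y j :: real)"
  by (simp add: sum_product)

text \<open>The second-order condition is tested with the columns v = x and v = y and the results
  are added. The multiplier side becomes the squared length of the sum of the rows, the other side
  the squared Frobenius norm of the 2 by 2 matrix with entries \<open>P\<close>, \<open>R\<close>,
  \<open>T\<close>, which is at least n^2/2 because P + T = n. The noise costs at most n^2/8 on each
  side, which leaves n^2/4.\<close>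

lemma correlation_lower_bound:
  fixes w :: "nat \<Rightarrow> nat \<Rightarrow> real" and x y :: "nat \<Rightarrow> real" and n :: nat and s K :: real
  defines "a \<equiv> \<lambda>i j. 1 + s * w i j"
  assumes op: "op_bound n w K"
    and s: "0 \<le> s" and sK: "s * K \<le> real n / 8"
    and unit: "\<And>i. i < n \<Longrightarrow> (x i)\<^sup>2 + (y i)\<^sup>2 = 1"
    and quad: "\<And>v. 0 \<le> (\<Sum>i<n. (\<Sum>j<n. a i j * (x i * x j + y i * y j)) * (v i)\<^sup>2)
        - (\<Sum>i<n. \<Sum>j<n. a i j * (x i * x j + y i * y j) * v i * v j)"
  shows "(real n)\<^sup>2 / 4 \<le> (\<Sum>i<n. x i)\<^sup>2 + (\<Sum>i<n. y i)\<^sup>2"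
proof -
  define B where "B = (\<lambda>u. \<Sum>i<n. \<Sum>j<n. w i j * u i * u j)"
  define L where "L = (\<lambda>i. \<Sum>j<n. a i j * (x i * x j + y i * y j))"
  define P R T where "P = (\<Sum>i<n. (x i)\<^sup>2)" and "R = (\<Sum>i<n. x i * y i)" and "T = (\<Sum>i<n. (y i)\<^sup>2)"
  have PT: "P + T = n"
    unfolding P_def T_def sum.distrib[symmetric] using unit by simp
  have "(\<Sum>i<n. L i * (x i)\<^sup>2) + (\<Sum>i<n. L i * (y i)\<^sup>2) = (\<Sum>i<n. L i)"
    unfolding sum.distrib[symmetric]
    by (intro sum.cong refl) (use unit in \<open>simp flip: distrib_left\<close>)
  also have "\<dots> = (\<Sum>i<n. \<Sum>j<n. x i * x j) + (\<Sum>i<n. \<Sum>j<n. y i * y j) + s * B x + s * B y"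
    unfolding L_def a_def B_def sum_distrib_left sum.distrib[symmetric]
    by (intro sum.cong refl) (simp add: algebra_simps)
  finally have e1: "(\<Sum>i<n. L i * (x i)\<^sup>2) + (\<Sum>i<n. L i * (y i)\<^sup>2)
     = (\<Sum>i<n. x i)\<^sup>2 + (\<Sum>i<n. y i)\<^sup>2 + s * B x + s * B y"
    unfolding sum_product_lessThan by (simp add: power2_eq_square)
  \<comment> \<open>Together the two tests weight \<open>a i j\<close> by the squared Gram entry,
    which splits into quadratic forms in the vectors x^2, xy and y^2, so operator norm bounds apply
    to the noise part.\<close>
  have "(\<Sum>i<n. \<Sum>j<n. a i j * (x i * x j + y i * y j) * x i * x j)
      + (\<Sum>i<n. \<Sum>j<n. a i j * (x i * x j + y i * y j) * y i * y j)
     = (\<Sum>i<n. \<Sum>j<n. (x i)\<^sup>2 * (x j)\<^sup>2) + 2 * (\<Sum>i<n. \<Sum>j<n. (x i * y i) * (x j * y j))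
      + (\<Sum>i<n. \<Sum>j<n. (y i)\<^sup>2 * (y j)\<^sup>2)
      + s * B (\<lambda>i. (x i)\<^sup>2) + 2 * (s * B (\<lambda>i. x i * y i)) + s * B (\<lambda>i. (y i)\<^sup>2)"
    unfolding a_def B_def sum_distrib_left sum.distrib[symmetric]
    by (intro sum.cong refl) (simp add: algebra_simps power2_eq_square)
  then have e2: "(\<Sum>i<n. \<Sum>j<n. a i j * (x i * x j + y i * y j) * x i * x j)
      + (\<Sum>i<n. \<Sum>j<n. a i j * (x i * x j + y i * y j) * y i * y j)
     = P\<^sup>2 + 2 * R\<^sup>2 + T\<^sup>2 + s * B (\<lambda>i. (x i)\<^sup>2) + 2 * (s * B (\<lambda>i. x i * y i)) + s * B (\<lambda>i. (y i)\<^sup>2)"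
    unfolding sum_product_lessThan P_def R_def T_def by (simp add: power2_eq_square)
  have Bq: "\<bar>B u\<bar> \<le> K * (\<Sum>i<n. (u i)\<^sup>2)" for u
    unfolding B_def by (rule op_bound_quadratic[OF op])
  have b: "B x + B y \<le> K * n"
    using Bq[of x] Bq[of y] PT unfolding P_def T_def
    by (smt (verit, best) distrib_left)
  \<comment> \<open>With weights 1, 2, 1 these three vectors have total squared norm n, since every
    row is a unit vector.\<close>
  have "(\<Sum>i<n. ((x i)\<^sup>2)\<^sup>2) + 2 * (\<Sum>i<n. (x i * y i)\<^sup>2) + (\<Sum>i<n. ((y i)\<^sup>2)\<^sup>2) = (\<Sum>i<n. ((x i)\<^sup>2 + (y i)\<^sup>2)\<^sup>2)"
    unfolding sum_distrib_left sum.distrib[symmetric]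
    by (intro sum.cong refl) (simp add: algebra_simps power2_eq_square)
  also have "\<dots> = n" using unit by simp
  finally have q: "K * (\<Sum>i<n. ((x i)\<^sup>2)\<^sup>2) + 2 * (K * (\<Sum>i<n. (x i * y i)\<^sup>2)) + K * (\<Sum>i<n. ((y i)\<^sup>2)\<^sup>2) = K * n"
    by (simp flip: distrib_left add: mult.left_commute[of 2 K])
  have c: "B (\<lambda>i. (x i)\<^sup>2) + 2 * B (\<lambda>i. x i * y i) + B (\<lambda>i. (y i)\<^sup>2) \<ge> - (K * n)"
    using Bq[of "\<lambda>i. (x i)\<^sup>2"] Bq[of "\<lambda>i. x i * y i"] Bq[of "\<lambda>i. (y i)\<^sup>2"] q
    by linarith
  have "P\<^sup>2 + 2 * R\<^sup>2 + T\<^sup>2 + s * (B (\<lambda>i. (x i)\<^sup>2) + 2 * B (\<lambda>i. x i * y i) + B (\<lambda>i. (y i)\<^sup>2))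
     \<le> (\<Sum>i<n. x i)\<^sup>2 + (\<Sum>i<n. y i)\<^sup>2 + s * (B x + B y)"
  proof -
    have "(\<Sum>i<n. \<Sum>j<n. a i j * (x i * x j + y i * y j) * v i * v j) \<le> (\<Sum>i<n. L i * (v i)\<^sup>2)" for v
      using quad[of v] unfolding L_def by simp
    from this[of x] this[of y] show ?thesis
      using e1 e2 by (simp only: distrib_left mult.left_commute[of s 2])
  qed
  moreover have "s * (B x + B y) \<le> s * (K * n)"
    by (rule mult_left_mono[OF b s])
  moreover have "s * (B (\<lambda>i. (x i)\<^sup>2) + 2 * B (\<lambda>i. x i * y i) + B (\<lambda>i. (y i)\<^sup>2)) \<ge> s * (- (K * n))"
    by (rule mult_left_mono[OF c s])
  moreover have "s * (K * n) \<le> (real n)\<^sup>2 / 8"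
    using mult_right_mono[OF sK, of n] by (simp add: power2_eq_square)
  moreover have "(real n)\<^sup>2 \<le> 2 * (P\<^sup>2 + T\<^sup>2)"
    unfolding PT[symmetric] using zero_le_power2[of "P - T"] by (simp add: power2_eq_square algebra_simps)
  moreover have "0 \<le> R\<^sup>2" by simp
  moreover have "N / 4 \<le> g + h"
    if "p + 2 * q + t + X \<le> g + h + Y" "Y \<le> Z" "- Z \<le> X" "Z \<le> N / 8" "N \<le> 2 * (p + t)" "0 \<le> q"
    for N g h p q t X Y Z :: real
    using that by simp
  ultimately show ?thesis by (simp only: mult_minus_right)
qed

text \<open>With u = (p, q) and e = (1, 0) this is the square of r |u - e| <= 2 |l u - r e|:
  normalizing a vector close to r e gives a direction close to e.\<close>

lemma normalized_vector_deviation: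
  fixes p q l r :: real
  assumes "p\<^sup>2 + q\<^sup>2 = 1" "0 \<le> l" "0 \<le> r"
  shows "r\<^sup>2 * ((1 - p)\<^sup>2 + q\<^sup>2) \<le> 4 * ((l * p - r)\<^sup>2 + (l * q)\<^sup>2)"
proof -
  have q2: "q\<^sup>2 = 1 - p\<^sup>2" using assms(1) by simp
  have "p\<^sup>2 \<le> 1" using assms(1) by (smt (verit) zero_le_power2)
  then have p1: "-1 \<le> p" "p \<le> 1" using abs_le_square_iff[of p 1] by auto
  \<comment> \<open>This is the difference of the two sides after substituting q^2 = 1 - p^2. For p
    >= 0 a square is completed; for p < 0 every term is nonnegative once 2 r^2 (1 + p) is
    grouped.\<close>
  have "0 \<le> 4 * l\<^sup>2 - 8 * l * p * r + 2 * r\<^sup>2 + 2 * r\<^sup>2 * p"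
  proof (cases "p \<ge> 0")
    case True
    have "4 * l\<^sup>2 - 8 * l * p * r + 2 * r\<^sup>2 + 2 * r\<^sup>2 * p = (2 * (l - p * r))\<^sup>2 + r\<^sup>2 * (2 * (1 - p) * (1 + 2 * p))"
      by (simp add: power2_eq_square algebra_simps)
    also have "\<dots> \<ge> 0" using True p1 by simp
    finally show ?thesis .
  next
    case False
    have "0 \<le> l * r * (- p)" using False assms(2,3) by (intro mult_nonneg_nonneg) auto
    moreover have "0 \<le> r\<^sup>2 * (1 + p)" using p1 by simp
    ultimately have "0 \<le> 4 * l\<^sup>2 + 8 * (l * r * (- p)) + 2 * (r\<^sup>2 * (1 + p))"
      using zero_le_power2[of l] by linarith
    then show ?thesis by (simp add: algebra_simps)
  qed
  then show ?thesis
    by (simp add: power_mult_distrib q2) (simp add: power2_eq_square algebra_simps)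
qed

text \<open>First |1 - p| <= 4 s K / sqrt n, from the deviation bound summed over the rows. Then W p
  differs from the row sums by W (1 - p) only, so each \<open>l i\<close> is at least n/4. Finally
  (n/4) |q| <= |l q| <= s K |q| with s K < n/8 forces q = 0.\<close>

lemma aligned_critical_point:
  fixes w :: "nat \<Rightarrow> nat \<Rightarrow> real" and p q l :: "nat \<Rightarrow> real" and n :: nat and s K L r :: real
  assumes op: "op_bound n w K" and K: "0 \<le> K" and s: "0 \<le> s"
    and row: "\<And>i. i < n \<Longrightarrow> \<bar>\<Sum>j<n. w i j\<bar> \<le> L"
    and sK: "s * K < real n / 8"
    and sL: "s * L + 4 * (s * K)\<^sup>2 / sqrt n \<le> real n / 4"
    and r: "real n / 2 \<le> r"
    and unit: "\<And>i. i < n \<Longrightarrow> (p i)\<^sup>2 + (q i)\<^sup>2 = 1"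
    and l: "\<And>i. i < n \<Longrightarrow> 0 \<le> l i"
    and lp: "\<And>i. i < n \<Longrightarrow> l i * p i = r + s * (\<Sum>j<n. w i j * p j)"
    and lq: "\<And>i. i < n \<Longrightarrow> l i * q i = s * (\<Sum>j<n. w i j * q j)"
    and i: "i < n"
  shows "p i = 1" "q i = 0"
proof -
  have n: "real n > 0" using i by simp
  have r0: "r > 0" using r n by linarith
  let ?W = "\<lambda>x i. \<Sum>j<n. w i j * x j"
  let ?N = "\<lambda>x. \<Sum>i<n. (x i)\<^sup>2"
  have Npq: "?N p + ?N q = n"
    unfolding sum.distrib[symmetric] using unit by simp
  have "r\<^sup>2 * ?N (\<lambda>i. 1 - p i) + r\<^sup>2 * ?N q \<le> (\<Sum>i<n. 4 * ((l i * p i - r)\<^sup>2 + (l i * q i)\<^sup>2))"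
    unfolding sum_distrib_left sum.distrib[symmetric]
    unfolding distrib_left[of "r\<^sup>2", symmetric]
    by (intro sum_mono normalized_vector_deviation) (use unit l r0 in auto)
  also have "\<dots> = 4 * s\<^sup>2 * (?N (?W p) + ?N (?W q))"
    unfolding sum_distrib_left sum.distrib[symmetric]
    by (intro sum.cong refl) (simp add: lp lq power_mult_distrib algebra_simps)
  also have "\<dots> \<le> 4 * s\<^sup>2 * (K\<^sup>2 * ?N p + K\<^sup>2 * ?N q)"
    by (intro mult_left_mono add_mono op_bound_mult_power2 op K) auto
  also have "\<dots> = 4 * (s * K)\<^sup>2 * n"
    by (simp flip: distrib_left add: Npq power_mult_distrib)
  finally have "r\<^sup>2 * ?N (\<lambda>i. 1 - p i) \<le> 4 * (s * K)\<^sup>2 * n"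
    using mult_nonneg_nonneg[OF zero_le_power2[of r] sum_nonneg[of "{..<n}" "\<lambda>i. (q i)\<^sup>2"]] by simp
  moreover have "(real n)\<^sup>2 / 4 \<le> r\<^sup>2"
    using power_mono[OF r, of 2] by (simp add: power_divide)
  ultimately have "(real n)\<^sup>2 / 4 * ?N (\<lambda>i. 1 - p i) \<le> 4 * (s * K)\<^sup>2 * n"
    by (meson mult_right_mono order_trans sum_nonneg zero_le_power2)
  then have "?N (\<lambda>i. 1 - p i) \<le> 16 * (s * K)\<^sup>2 / n"
    using n by (simp add: field_simps power2_eq_square)
  then have "L2_set (\<lambda>i. 1 - p i) {..<n} \<le> sqrt (16 * (s * K)\<^sup>2 / n)"
    unfolding L2_set_def by (rule real_sqrt_le_mono)
  also have "\<dots> = 4 * (s * K) / sqrt n"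
    using s K by (simp add: real_sqrt_divide real_sqrt_mult)
  finally have dev: "L2_set (\<lambda>i. 1 - p i) {..<n} \<le> 4 * (s * K) / sqrt n" .
  \<comment> \<open>The row-sum bound \<open>L\<close> controls W applied to the all-ones vector
    entrywise; only the short remainder W (1 - p) is bounded through its Euclidean norm.\<close>
  have lp_large: "l i * p i \<ge> n / 4" if i: "i < n" for i
  proof -
    have "\<bar>?W (\<lambda>i. 1 - p i) i\<bar> \<le> L2_set (?W (\<lambda>i. 1 - p i)) {..<n}"
      using member_le_L2_set[of "{..<n}" i "\<lambda>i. \<bar>?W (\<lambda>i. 1 - p i) i\<bar>"] i by (simp add: L2_set_def)
    also have "\<dots> \<le> K * (4 * (s * K) / sqrt n)"
      using op_bound_mult[OF op K, of "\<lambda>i. 1 - p i"] mult_left_mono[OF dev K] by linarith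
    finally have "\<bar>?W (\<lambda>i. 1 - p i) i\<bar> \<le> K * (4 * (s * K) / sqrt n)" .
    moreover have "?W p i = (\<Sum>j<n. w i j) - ?W (\<lambda>i. 1 - p i) i"
      by (simp add: algebra_simps sum_subtractf)
    ultimately have "\<bar>?W p i\<bar> \<le> L + K * (4 * (s * K) / sqrt n)"
      using row[OF i] by linarith
    then have "s * \<bar>?W p i\<bar> \<le> s * (L + K * (4 * (s * K) / sqrt n))"
      using s by (rule mult_left_mono)
    also have "\<dots> = s * L + 4 * (s * K)\<^sup>2 / sqrt n"
      by (simp add: algebra_simps power2_eq_square)
    finally have "\<bar>s * ?W p i\<bar> \<le> n / 4" using sL s by (simp add: abs_mult)
    then show "l i * p i \<ge> n / 4" using lp[OF i] r by linarith
  qed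
  have l_large: "l i \<ge> n / 4" if i: "i < n" for i
  proof -
    have "p i \<le> 1"
      using unit[OF i] abs_le_square_iff[of "p i" 1] by (smt (verit) one_power2 zero_le_power2)
    then have "l i * p i \<le> l i" using l[OF i] by (simp add: mult_left_le)
    then show ?thesis using lp_large[OF i] by linarith
  qed
  have "(n / 4)\<^sup>2 * ?N q \<le> (\<Sum>i<n. (l i * q i)\<^sup>2)"
    unfolding sum_distrib_left power_mult_distrib
    by (intro sum_mono mult_right_mono power_mono) (use l_large in auto)
  also have "\<dots> = s\<^sup>2 * ?N (?W q)"
    unfolding sum_distrib_left by (intro sum.cong refl) (simp add: lq power_mult_distrib)
  also have "\<dots> \<le> s\<^sup>2 * (K\<^sup>2 * ?N q)"
    by (intro mult_left_mono op_bound_mult_power2 op K) auto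
  also have "\<dots> = (s * K)\<^sup>2 * ?N q" by (simp add: power_mult_distrib)
  also have "\<dots> \<le> (n / 8)\<^sup>2 * ?N q"
    by (intro mult_right_mono power_mono) (use sK s K in \<open>auto intro: sum_nonneg\<close>)
  finally have "?N q \<le> 0" using n by (simp add: power_divide)
  then have "?N q = 0" by (simp add: sum_nonneg antisym)
  then have "\<forall>i\<in>{..<n}. (q i)\<^sup>2 = 0"
    by (subst (asm) sum_nonneg_eq_0_iff) auto
  then show q: "q i = 0" using i by simp
  have "(p i)\<^sup>2 = 1" using unit[OF i] q by simp
  moreover have "p i > 0"
    using lp_large[OF i] l[OF i] n by (smt (verit) divide_pos_pos mult_nonneg_nonpos)
  ultimately show "p i = 1" by (simp add: power2_eq_1_iff)
qed

text \<open>Rotating all rows by a common angle preserves the Gram matrix and the form of the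
  first-order equations, so the sum of the rows may be taken to be (r, 0). The aligned case then
  shows that all rotated rows equal (1, 0).\<close>

lemma critical_point_ones:
  fixes w :: "nat \<Rightarrow> nat \<Rightarrow> real" and x y :: "nat \<Rightarrow> real" and n :: nat and s K L :: real
  defines "a \<equiv> \<lambda>i j. 1 + s * w i j"
  assumes op: "op_bound n w K" and K: "0 \<le> K" and s: "0 \<le> s"
    and diag: "\<And>i. w i i = 0"
    and row: "\<And>i. i < n \<Longrightarrow> \<bar>\<Sum>j<n. w i j\<bar> \<le> L"
    and sK: "s * K < real n / 8"
    and sL: "s * L + 4 * (s * K)\<^sup>2 / sqrt n \<le> real n / 4"
    and unit: "\<And>i. i < n \<Longrightarrow> (x i)\<^sup>2 + (y i)\<^sup>2 = 1"
    and fx: "\<And>i. i < n \<Longrightarrow> (\<Sum>j<n. a i j * (x i * x j + y i * y j)) * x i = (\<Sum>j<n. a i j * x j)"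
    and fy: "\<And>i. i < n \<Longrightarrow> (\<Sum>j<n. a i j * (x i * x j + y i * y j)) * y i = (\<Sum>j<n. a i j * y j)"
    and quad: "\<And>v. 0 \<le> (\<Sum>i<n. (\<Sum>j<n. a i j * (x i * x j + y i * y j)) * (v i)\<^sup>2)
        - (\<Sum>i<n. \<Sum>j<n. a i j * (x i * x j + y i * y j) * v i * v j)"
    and i: "i < n" and j: "j < n"
  shows "x i * x j + y i * y j = 1"
proof -
  define l where "l = (\<lambda>i. \<Sum>j<n. a i j * (x i * x j + y i * y j))"
  define r where "r = sqrt ((\<Sum>i<n. x i)\<^sup>2 + (\<Sum>i<n. y i)\<^sup>2)"
  define b c where "b = (\<Sum>i<n. x i) / r" and "c = (\<Sum>i<n. y i) / r"
  define p q where "p = (\<lambda>i. b * x i + c * y i)" and "q = (\<lambda>i. b * y i - c * x i)"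
  have n: "real n > 0" using i by simp
  have corr: "(real n)\<^sup>2 / 4 \<le> (\<Sum>i<n. x i)\<^sup>2 + (\<Sum>i<n. y i)\<^sup>2"
    using correlation_lower_bound[OF op s less_imp_le[OF sK] unit quad[unfolded a_def]] by simp
  have "sqrt ((real n)\<^sup>2 / 4) \<le> r"
    unfolding r_def by (rule real_sqrt_le_mono[OF corr])
  then have r: "n / 2 \<le> r" by (simp add: real_sqrt_divide)
  then have r0: "r > 0" using n by linarith
  have r2: "(\<Sum>i<n. x i)\<^sup>2 + (\<Sum>i<n. y i)\<^sup>2 = r\<^sup>2"
    unfolding r_def by simp
  have bc: "b\<^sup>2 + c\<^sup>2 = 1"
    unfolding b_def c_def power_divide add_divide_distrib[symmetric] r2 using r0 by simp
  have sp: "(\<Sum>i<n. p i) = r"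
  proof -
    have "(\<Sum>i<n. p i) = b * (\<Sum>i<n. x i) + c * (\<Sum>i<n. y i)"
      unfolding p_def by (simp add: sum.distrib sum_distrib_left)
    also have "\<dots> = r\<^sup>2 / r"
      unfolding b_def c_def r2[symmetric] by (simp add: power2_eq_square add_divide_distrib)
    finally show ?thesis using r0 by (simp add: power2_eq_square)
  qed
  have sq: "(\<Sum>i<n. q i) = 0"
  proof -
    have "(\<Sum>i<n. q i) = b * (\<Sum>i<n. y i) - c * (\<Sum>i<n. x i)"
      unfolding q_def by (simp add: sum_subtractf sum_distrib_left)
    then show ?thesis unfolding b_def c_def by simp
  qed
  have rot: "p i * p j + q i * q j = x i * x j + y i * y j" for i j
  proof -
    have "p i * p j + q i * q j = (b\<^sup>2 + c\<^sup>2) * (x i * x j + y i * y j)"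
      unfolding p_def q_def by (simp add: algebra_simps power2_eq_square)
    then show ?thesis unfolding bc by simp
  qed
  have u: "(p i)\<^sup>2 + (q i)\<^sup>2 = 1" if "i < n" for i
    using rot[of i i] unit[OF that] by (simp add: power2_eq_square)
  \<comment> \<open>The test vector is the i-th basis vector; as the diagonal noise vanishes, the
    condition reads \<open>l i\<close> - 1 >= 0.\<close>
  have l0: "0 \<le> l i" if i: "i < n" for i
  proof -
    let ?v = "\<lambda>k. if k = i then 1 else 0"
    have "(\<Sum>k<n. (\<Sum>j<n. a k j * (x k * x j + y k * y j)) * (?v k)\<^sup>2) = (\<Sum>k<n. if k = i then l k else 0)"
      by (intro sum.cong refl) (auto simp: l_def)
    also have "\<dots> = l i" using i by simp
    finally have 1: "(\<Sum>k<n. (\<Sum>j<n. a k j * (x k * x j + y k * y j)) * (?v k)\<^sup>2) = l i" .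
    have "(\<Sum>k<n. \<Sum>j<n. a k j * (x k * x j + y k * y j) * ?v k * ?v j)
      = (\<Sum>k<n. if k = i then \<Sum>j<n. if j = i then a k j * (x k * x j + y k * y j) else 0 else 0)"
      by (intro sum.cong refl) (auto simp: if_distrib cong: if_cong)
    also have "\<dots> = a i i * (x i * x i + y i * y i)" using i by simp
    also have "\<dots> = 1" using unit[OF i] diag by (simp add: a_def power2_eq_square)
    finally show ?thesis using quad[of ?v] 1 by simp
  qed
  have lp: "l i * p i = r + s * (\<Sum>j<n. w i j * p j)" if i: "i < n" for i
  proof -
    have "l i * p i = b * (l i * x i) + c * (l i * y i)" by (simp add: p_def algebra_simps)
    also have "\<dots> = b * (\<Sum>j<n. a i j * x j) + c * (\<Sum>j<n. a i j * y j)"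
      using fx[OF i] fy[OF i] by (simp add: l_def)
    also have "\<dots> = (\<Sum>j<n. p j) + s * (\<Sum>j<n. w i j * p j)"
      by (simp add: p_def a_def sum_distrib_left sum.distrib algebra_simps)
    finally show ?thesis unfolding sp .
  qed
  have lq: "l i * q i = s * (\<Sum>j<n. w i j * q j)" if i: "i < n" for i
  proof -
    have "l i * q i = b * (l i * y i) - c * (l i * x i)" by (simp add: q_def algebra_simps)
    also have "\<dots> = b * (\<Sum>j<n. a i j * y j) - c * (\<Sum>j<n. a i j * x j)"
      using fx[OF i] fy[OF i] by (simp add: l_def)
    also have "\<dots> = (\<Sum>j<n. q j) + s * (\<Sum>j<n. w i j * q j)"
      by (simp add: q_def a_def sum_distrib_left sum.distrib sum_subtractf algebra_simps)
    finally show ?thesis unfolding sq by simp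
  qed
  note al = aligned_critical_point[OF op K s row sK sL r u l0 lp lq]
  have "x i * x j + y i * y j = p i * p j + q i * q j" by (simp only: rot)
  then show ?thesis using al(1)[OF _ _ _ _ _ i] al(2)[OF _ _ _ _ _ i] al(1)[OF _ _ _ _ _ j] by simp
qed

section \<open>Sign conjugation and the dual certificate for the all-ones matrix\<close>

lemma op_bound_conjugate:
  assumes "op_bound n w K" and z: "\<And>i. i < n \<Longrightarrow> (z i)\<^sup>2 = 1"
  shows "op_bound n (\<lambda>i j. z i * z j * w i j) K"
  unfolding op_bound_def
proof (intro allI)
  fix x y
  have L2: "L2_set (\<lambda>i. z i * u i) {..<n} = L2_set u {..<n}" for u
    unfolding L2_set_def by (intro arg_cong[of _ _ sqrt] sum.cong refl) (simp add: power_mult_distrib z)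
  have "(\<Sum>i<n. \<Sum>j<n. z i * z j * w i j * x i * y j) = (\<Sum>i<n. \<Sum>j<n. w i j * (z i * x i) * (z j * y j))"
    by (intro sum.cong refl) (simp add: mult_ac)
  also have "\<dots> \<le> K * L2_set (\<lambda>i. z i * x i) {..<n} * L2_set (\<lambda>j. z j * y j) {..<n}"
    using assms(1)[unfolded op_bound_def, THEN spec, THEN spec] .
  finally show "(\<Sum>i<n. \<Sum>j<n. z i * z j * w i j * x i * y j) \<le> K * L2_set x {..<n} * L2_set y {..<n}"
    unfolding L2 .
qed

text \<open>The Laplacian-type form below annihilates constant vectors, so it suffices to bound it after
  centering.\<close>

lemma ones_certificate:
  fixes w :: "nat \<Rightarrow> nat \<Rightarrow> real" and x :: "nat \<Rightarrow> real" and n :: nat and s K L :: real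
  defines "a \<equiv> \<lambda>i j. 1 + s * w i j"
  assumes op: "op_bound n w K" and s: "0 \<le> s"
    and sym: "\<And>i j. w i j = w j i"
    and row: "\<And>i. i < n \<Longrightarrow> \<bar>\<Sum>j<n. w i j\<bar> \<le> L"
    and sKL: "s * L + s * K \<le> real n"
  shows "(\<Sum>i<n. \<Sum>j<n. a i j * x i * x j) \<le> (\<Sum>i<n. \<Sum>j<n. a i j * (x i)\<^sup>2)"
proof (cases "n = 0")
  case False
  define m where "m = (\<Sum>i<n. x i) / n"
  define u where "u = (\<lambda>i. x i - m)"
  have su: "(\<Sum>i<n. u i) = 0"
    using False by (simp add: u_def m_def sum_subtractf)
  have x: "x = (\<lambda>i. u i + m)" by (simp add: u_def)
  let ?D = "\<lambda>x. \<Sum>i<n. \<Sum>j<n. a i j * (x i - x j)\<^sup>2"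
  have key: "?D x = 2 * (\<Sum>i<n. \<Sum>j<n. a i j * (x i)\<^sup>2) - 2 * (\<Sum>i<n. \<Sum>j<n. a i j * x i * x j)" for x
  proof -
    have "(\<Sum>i<n. \<Sum>j<n. a i j * (x j)\<^sup>2) = (\<Sum>i<n. \<Sum>j<n. a i j * (x i)\<^sup>2)"
      by (subst sum.swap) (simp add: a_def sym)
    moreover have "?D x = (\<Sum>i<n. \<Sum>j<n. a i j * (x i)\<^sup>2) + (\<Sum>i<n. \<Sum>j<n. a i j * (x j)\<^sup>2)
        - 2 * (\<Sum>i<n. \<Sum>j<n. a i j * x i * x j)"
      unfolding sum_distrib_left sum.distrib[symmetric] sum_subtractf[symmetric]
      by (intro sum.cong refl) (simp add: power2_eq_square algebra_simps)
    ultimately show ?thesis by simp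
  qed
  have "?D x = ?D u" unfolding x by simp
  also have "\<dots> \<ge> 0"
  proof -
    have rows: "(\<Sum>j<n. a i j) \<ge> n - s * L" if "i < n" for i
    proof -
      have "s * (\<Sum>j<n. w i j) \<ge> s * (- L)"
        using row[OF that] by (intro mult_left_mono s) simp
      then show ?thesis by (simp add: a_def sum.distrib sum_distrib_left)
    qed
    have "(n - s * L) * (\<Sum>i<n. (u i)\<^sup>2) \<le> (\<Sum>i<n. \<Sum>j<n. a i j * (u i)\<^sup>2)"
      unfolding sum_distrib_left sum_distrib_right[symmetric]
      by (intro sum_mono mult_right_mono rows) auto
    moreover have "(\<Sum>i<n. \<Sum>j<n. a i j * u i * u j) = (\<Sum>i<n. \<Sum>j<n. u i * u j) + s * (\<Sum>i<n. \<Sum>j<n. w i j * u i * u j)"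
      unfolding sum_distrib_left sum.distrib[symmetric]
      by (intro sum.cong refl) (simp add: a_def algebra_simps)
    moreover have "s * (\<Sum>i<n. \<Sum>j<n. w i j * u i * u j) \<le> s * (K * (\<Sum>i<n. (u i)\<^sup>2))"
      using op_bound_quadratic[OF op, of u] by (intro mult_left_mono s) simp
    moreover have "(\<Sum>i<n. \<Sum>j<n. u i * u j) = 0"
      unfolding sum_product_lessThan su by simp
    \<comment> \<open>For the centered vector \<open>u\<close> the all-ones part of \<open>a\<close>
      contributes nothing to the cross terms, so the gap is at least (n - s L - s K) |u|^2.\<close>
    moreover have "0 \<le> (n - s * L - s * K) * (\<Sum>i<n. (u i)\<^sup>2)"
      using sKL by (intro mult_nonneg_nonneg sum_nonneg) auto
    ultimately show ?thesis unfolding key by (simp add: algebra_simps)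
  qed
  finally show ?thesis unfolding key by simp
qed simp

section \<open>Bounds for the Gaussian noise\<close>

text \<open>Completing the square: tilting the standard normal density by exp (c x) gives exp (c^2 /
  2) times the normal density with mean c.\<close>

lemma nn_integral_exp_std_normal:
  "(\<integral>\<^sup>+x. ennreal (exp (c * x)) \<partial>std_normal) = ennreal (exp (c\<^sup>2 / 2))"
proof -
  have "(\<integral>\<^sup>+x. ennreal (exp (c * x)) \<partial>std_normal)
      = (\<integral>\<^sup>+x. ennreal (std_normal_density x) * ennreal (exp (c * x)) \<partial>lborel)"
    by (subst nn_integral_density) auto
  also have "\<dots> = (\<integral>\<^sup>+x. ennreal (exp (c\<^sup>2 / 2)) * ennreal (normal_density c 1 x) \<partial>lborel)"
  proof (intro nn_integral_cong)
    fix x :: real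
    have "- x\<^sup>2 / 2 + c * x = c\<^sup>2 / 2 - (x - c)\<^sup>2 / 2"
      by (simp add: power2_eq_square field_simps)
    then have "exp (- x\<^sup>2 / 2) * exp (c * x) = exp (c\<^sup>2 / 2) * exp (- (x - c)\<^sup>2 / 2)"
      by (simp flip: exp_add)
    then show "ennreal (std_normal_density x) * ennreal (exp (c * x)) = ennreal (exp (c\<^sup>2 / 2)) * ennreal (normal_density c 1 x)"
      by (simp add: normal_density_def flip: ennreal_mult)
  qed
  also have "\<dots> = ennreal (exp (c\<^sup>2 / 2)) * (\<integral>\<^sup>+x. ennreal (normal_density c 1 x) \<partial>lborel)"
    by (rule nn_integral_cmult) auto
  also have "(\<integral>\<^sup>+x. ennreal (normal_density c 1 x) \<partial>lborel) = 1"
    using prob_space.emeasure_space_1[OF prob_space_normal_density[of 1 c]]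
    by (simp add: emeasure_density)
  finally show ?thesis by simp
qed

text \<open>The Chernoff bound: by independence the exponential moment of the linear form factors
  into Gaussian ones, and \<open>v\<close> bounds the variance.\<close>

lemma wigner_space_linear_tail:
  assumes v: "(\<Sum>p\<in>below_diag n. (c p)\<^sup>2) \<le> v" and v0: "0 < v" and t: "0 < t"
  shows "measure (wigner_space n) {w \<in> space (wigner_space n). t \<le> (\<Sum>p\<in>below_diag n. c p * w p)}
    \<le> exp (- t\<^sup>2 / (2 * v))"
proof -
  interpret P: product_prob_space "\<lambda>_. std_normal"
    by (intro product_prob_spaceI prob_space_std_normal)
  interpret W: prob_space "wigner_space n" by (rule prob_space_wigner_space)
  let ?f = "\<lambda>w. \<Sum>p\<in>below_diag n. c p * w p"
  \<comment> \<open>The minimizer of s^2 v / 2 - s t over s.\<close>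
  let ?s = "t / v"
  have meas: "?f \<in> borel_measurable (wigner_space n)"
    unfolding wigner_space_def by measurable
  have "(\<integral>\<^sup>+w. ennreal (exp (?s * ?f w)) \<partial>wigner_space n)
      = (\<integral>\<^sup>+w. (\<Prod>p\<in>below_diag n. ennreal (exp (?s * c p * w p))) \<partial>wigner_space n)"
    by (intro nn_integral_cong) (simp add: prod_ennreal exp_sum[OF finite_below_diag] sum_distrib_left mult.assoc flip: exp_sum)
  also have "\<dots> = (\<Prod>p\<in>below_diag n. \<integral>\<^sup>+x. ennreal (exp (?s * c p * x)) \<partial>std_normal)"
    unfolding wigner_space_def by (rule P.product_nn_integral_prod[OF finite_below_diag]) auto
  also have "\<dots> = ennreal (exp (\<Sum>p\<in>below_diag n. (?s * c p)\<^sup>2 / 2))"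
    by (simp only: nn_integral_exp_std_normal) (simp add: prod_ennreal exp_sum finite_below_diag)
  also have "\<dots> \<le> ennreal (exp (t\<^sup>2 / (2 * v)))"
  proof -
    have "(\<Sum>p\<in>below_diag n. (?s * c p)\<^sup>2 / 2) = ?s\<^sup>2 / 2 * (\<Sum>p\<in>below_diag n. (c p)\<^sup>2)"
      by (simp add: power_mult_distrib sum_distrib_left sum_divide_distrib power_divide)
    also have "\<dots> \<le> ?s\<^sup>2 / 2 * v"
      by (intro mult_left_mono v) auto
    also have "\<dots> = t\<^sup>2 / (2 * v)"
      using v0 by (simp add: power2_eq_square field_simps)
    finally show ?thesis by simp
  qed
  finally have mgf: "(\<integral>\<^sup>+w. ennreal (exp (?s * ?f w)) \<partial>wigner_space n) \<le> ennreal (exp (t\<^sup>2 / (2 * v)))" .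
  have "emeasure (wigner_space n) {w \<in> space (wigner_space n). t \<le> ?f w}
     \<le> ennreal (exp (- ?s * t)) * (\<integral>\<^sup>+w. ennreal (exp (?s * ?f w)) * indicator (space (wigner_space n)) w \<partial>wigner_space n)"
    using t v0 meas by (intro Chernoff_ineq_nn_integral_ge) auto
  also have "(\<integral>\<^sup>+w. ennreal (exp (?s * ?f w)) * indicator (space (wigner_space n)) w \<partial>wigner_space n)
     = (\<integral>\<^sup>+w. ennreal (exp (?s * ?f w)) \<partial>wigner_space n)"
    by (intro nn_integral_cong) simp
  also have "ennreal (exp (- ?s * t)) * \<dots> \<le> ennreal (exp (- ?s * t)) * ennreal (exp (t\<^sup>2 / (2 * v)))"
    by (intro mult_left_mono mgf) auto
  also have "\<dots> = ennreal (exp (- t\<^sup>2 / (2 * v)))"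
  proof -
    have "- ?s * t + t\<^sup>2 / (2 * v) = - t\<^sup>2 / (2 * v)"
      using v0 by (simp add: power2_eq_square field_simps)
    then show ?thesis by (simp flip: ennreal_mult exp_add)
  qed
  finally show ?thesis
    by (simp add: W.emeasure_eq_measure)
qed

text \<open>Defined for all indices, also beyond n, so that symmetry and the zero diagonal hold
  without side conditions.\<close>

definition wigner_entry :: "(nat \<times> nat \<Rightarrow> real) \<Rightarrow> nat \<Rightarrow> nat \<Rightarrow> real" where
  "wigner_entry w i j = (if j < i then w (i, j) else if i < j then w (j, i) else 0)"

text \<open>Folding the part above the diagonal onto the part below exposes a linear form in
  independent coordinates, as the Chernoff bound requires.\<close>

lemma wigner_bilinear:
  "(\<Sum>i<n. \<Sum>j<n. wigner_entry w i j * x i * y j) = (\<Sum>(i, j)\<in>below_diag n. (x i * y j + x j * y i) * w (i, j))"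
proof -
  let ?S = "\<lambda>P f. \<Sum>i<n. \<Sum>j<n. if P i j then f i j else (0::real)"
  have below: "(\<Sum>(i, j)\<in>below_diag n. f i j) = ?S (\<lambda>i j. j < i) f" for f :: "nat \<Rightarrow> nat \<Rightarrow> real"
  proof -
    have "?S (\<lambda>i j. j < i) f = (\<Sum>(i, j)\<in>{..<n} \<times> {..<n}. if j < i then f i j else 0)"
      by (simp add: sum.cartesian_product)
    also have "\<dots> = (\<Sum>(i, j)\<in>below_diag n. f i j)"
      by (intro sum.mono_neutral_cong_right) (auto simp: below_diag_def split: if_splits)
    finally show ?thesis ..
  qed
  have "(\<Sum>i<n. \<Sum>j<n. wigner_entry w i j * x i * y j)
     = ?S (\<lambda>i j. j < i) (\<lambda>i j. x i * y j * w (i, j)) + ?S (\<lambda>i j. i < j) (\<lambda>i j. x i * y j * w (j, i))"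
    unfolding sum.distrib[symmetric]
    by (intro sum.cong refl) (auto simp: wigner_entry_def)
  also have "?S (\<lambda>i j. i < j) (\<lambda>i j. x i * y j * w (j, i)) = ?S (\<lambda>i j. j < i) (\<lambda>i j. x j * y i * w (i, j))"
    by (rule sum.swap)
  finally show ?thesis
    unfolding below sum.distrib[symmetric]
    by (simp add: if_distrib distrib_right cong: if_cong)
qed

text \<open>Bounds the variance of the bilinear form. By (a + b)^2 <= 2 (a^2 + b^2) it is at most
  twice the sum of x_i^2 y_j^2 over the below-diagonal pairs and their transposes, which are
  disjoint parts of the full square.\<close>

lemma below_diag_variance:
  "(\<Sum>(i, j)\<in>below_diag n. (x i * y j + x j * y i)\<^sup>2) \<le> 2 * ((\<Sum>i<n. (x i)\<^sup>2) * (\<Sum>i<n. (y i :: real)\<^sup>2))"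
proof -
  let ?g = "\<lambda>(i, j). (x i)\<^sup>2 * (y j)\<^sup>2"
  have "(\<Sum>(i, j)\<in>below_diag n. (x i * y j + x j * y i)\<^sup>2) \<le> (\<Sum>p\<in>below_diag n. 2 * (?g p + ?g (prod.swap p)))"
  proof (intro sum_mono, clarsimp)
    fix i j
    have "2 * ((x i)\<^sup>2 * (y j)\<^sup>2 + (x j)\<^sup>2 * (y i)\<^sup>2) - (x i * y j + x j * y i)\<^sup>2 = (x i * y j - x j * y i)\<^sup>2"
      by (simp add: power2_eq_square algebra_simps)
    also have "\<dots> \<ge> 0" by simp
    finally show "(x i * y j + x j * y i)\<^sup>2 \<le> 2 * ((x i)\<^sup>2 * (y j)\<^sup>2) + 2 * ((x j)\<^sup>2 * (y i)\<^sup>2)" by simp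
  qed
  also have "\<dots> = 2 * (sum ?g (below_diag n) + sum ?g (prod.swap ` below_diag n))"
    by (simp add: sum.reindex sum.distrib flip: sum_distrib_left)
  also have "sum ?g (below_diag n) + sum ?g (prod.swap ` below_diag n) = sum ?g (below_diag n \<union> prod.swap ` below_diag n)"
    by (intro sum.union_disjoint[symmetric]) (auto simp: finite_below_diag, auto simp: below_diag_def)
  also have "\<dots> \<le> sum ?g ({..<n} \<times> {..<n})"
    by (intro sum_mono2) (auto simp: below_diag_def)
  also have "\<dots> = (\<Sum>i<n. (x i)\<^sup>2) * (\<Sum>i<n. (y i)\<^sup>2)"
    by (simp add: sum_product sum.cartesian_product)
  finally show ?thesis by simp
qed

lemma wigner_bilinear_tail:
  assumes "(\<Sum>i<n. (x i)\<^sup>2) * (\<Sum>i<n. (y i)\<^sup>2) \<le> v" "0 < v" "0 < t"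
  shows "measure (wigner_space n)
      {w \<in> space (wigner_space n). t \<le> (\<Sum>i<n. \<Sum>j<n. wigner_entry w i j * x i * y j)} \<le> exp (- t\<^sup>2 / (4 * v))"
proof -
  have "(\<Sum>p\<in>below_diag n. (case p of (i, j) \<Rightarrow> x i * y j + x j * y i)\<^sup>2) \<le> 2 * v"
    using below_diag_variance[of x y n] assms(1) by (simp add: case_prod_beta')
  from wigner_space_linear_tail[OF this, of t] assms(2,3) show ?thesis
    unfolding wigner_bilinear by (simp add: case_prod_beta')
qed

lemma wigner_bilinear_measurable:
  "(\<lambda>w. \<Sum>i<n. \<Sum>j<n. wigner_entry w i j * x i * y j) \<in> borel_measurable (wigner_space n)"
  unfolding wigner_bilinear wigner_space_def case_prod_beta' prod.collapse by measurable

section \<open>Rounding the unit ball to a finite grid\<close>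

definition grid :: "nat \<Rightarrow> (nat \<Rightarrow> real) set" where
  "grid n = {..<n} \<rightarrow>\<^sub>E (\<lambda>k::int. k / n) ` {- int n..int n}"

lemma finite_grid: "finite (grid n)"
  unfolding grid_def by (intro finite_PiE) auto

text \<open>The logarithm of this bound is of order n log n, a logarithmic factor worse than for an
  optimal net. The Gaussian tail at t = n^(13/24), with exponent n^(13/12)/4, absorbs it.\<close>

lemma card_grid_le: "card (grid n) \<le> (2 * n + 1) ^ n"
proof -
  have "card ((\<lambda>k::int. k / real n) ` {- int n..int n}) \<le> 2 * n + 1"
    using card_image_le[of "{- int n..int n}" "\<lambda>k::int. k / real n"] by (simp add: nat_add_distrib)
  then show ?thesis
    unfolding grid_def by (simp add: card_PiE power_mono)
qed

lemma L2_set_le_one_imp_abs_le_one: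
  fixes n :: nat
  assumes "L2_set x {..<n} \<le> 1" "i < n"
  shows "\<bar>x i\<bar> \<le> 1"
proof -
  have "\<bar>x i\<bar> \<le> L2_set (\<lambda>i. \<bar>x i\<bar>) {..<n}"
    by (rule member_le_L2_set) (use assms(2) in auto)
  also have "\<dots> = L2_set x {..<n}" by (simp add: L2_set_def)
  finally show ?thesis using assms(1) by linarith
qed

text \<open>Rounding each coordinate towards zero to a multiple of 1/n does not increase the norm,
  and the error is at most sqrt (n / n^2) = 1 / sqrt n, which is at most 1/4 from n = 16 on.\<close>

lemma grid_approximation:
  assumes x: "L2_set x {..<n} \<le> 1" and n: "16 \<le> n"
  obtains y where "y \<in> grid n" "L2_set y {..<n} \<le> 1" "L2_set (\<lambda>i. x i - y i) {..<n} \<le> 1 / 4"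
proof -
  define k where "k = (\<lambda>i. \<lfloor>n * \<bar>x i\<bar>\<rfloor>)"
  define y where "y = (\<lambda>i\<in>{..<n}. real_of_int (if x i \<ge> 0 then k i else - k i) / n)"
  have k: "0 \<le> k i" "k i \<le> n" if "i < n" for i
  proof -
    show "0 \<le> k i" by (simp add: k_def)
    have "real n * \<bar>x i\<bar> \<le> n"
      using L2_set_le_one_imp_abs_le_one[OF x that] by (simp add: mult_left_le)
    then show "k i \<le> n" unfolding k_def by linarith
  qed
  have kn: "k i / n \<le> \<bar>x i\<bar>" "\<bar>x i\<bar> - k i / n \<le> 1 / n" for i
  proof -
    have "k i \<le> n * \<bar>x i\<bar>" "n * \<bar>x i\<bar> \<le> k i + 1" unfolding k_def by linarith+
    then have "k i / n \<le> n * \<bar>x i\<bar> / n" "n * \<bar>x i\<bar> / n \<le> (k i + 1) / n"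
      by (intro divide_right_mono; simp)+
    then show "k i / n \<le> \<bar>x i\<bar>" "\<bar>x i\<bar> - k i / n \<le> 1 / n"
      using n by (simp_all add: add_divide_distrib)
  qed
  have "y \<in> grid n"
    unfolding grid_def y_def using k by (intro restrict_PiE_iff[THEN iffD2] ballI image_eqI[OF refl]) force
  moreover have "L2_set y {..<n} \<le> L2_set x {..<n}"
    unfolding L2_set_def
  proof (intro real_sqrt_le_mono sum_mono)
    fix i assume i: "i \<in> {..<n}"
    have "\<bar>y i\<bar> = k i / n" using i k[of i] by (simp add: y_def)
    then have "\<bar>y i\<bar> \<le> \<bar>x i\<bar>" using kn by simp
    then show "(y i)\<^sup>2 \<le> (x i)\<^sup>2" by (simp only: abs_le_square_iff)
  qed
  moreover have "L2_set (\<lambda>i. x i - y i) {..<n} \<le> sqrt (\<Sum>i<n. (1 / n)\<^sup>2)"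
    unfolding L2_set_def
  proof (intro real_sqrt_le_mono sum_mono)
    fix i assume i: "i \<in> {..<n}"
    have "\<bar>x i - y i\<bar> \<le> \<bar>1 / n\<bar>" using i kn[of i] by (simp add: y_def abs_if split: if_splits)
    then show "(x i - y i)\<^sup>2 \<le> (1 / real n)\<^sup>2" by (simp only: abs_le_square_iff)
  qed
  moreover have "sqrt (\<Sum>i<n. (1 / real n)\<^sup>2) = sqrt (1 / n)"
    using n by (simp add: power2_eq_square)
  moreover have "sqrt (1 / n) \<le> sqrt ((1 / 4)\<^sup>2)"
    using n by (intro real_sqrt_le_mono) (simp add: power2_eq_square field_simps)
  ultimately show thesis using that x by simp
qed

text \<open>The optimal bound \<open>b\<close> for the bilinear form satisfies \<open>b \<le> t + b / 4 + b / 4\<close>, by rounding both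
  arguments to the grid.\<close>

lemma op_bound_of_grid:
  fixes w :: "nat \<Rightarrow> nat \<Rightarrow> real"
  assumes n: "16 \<le> n"
    and grid: "\<And>x y. x \<in> grid n \<Longrightarrow> y \<in> grid n \<Longrightarrow> L2_set x {..<n} \<le> 1 \<Longrightarrow> L2_set y {..<n} \<le> 1 \<Longrightarrow>
      (\<Sum>i<n. \<Sum>j<n. w i j * x i * y j) \<le> t"
  shows "op_bound n w (2 * t)"
proof -
  define B where "B = (\<lambda>x y. \<Sum>i<n. \<Sum>j<n. w i j * x i * y j)"
  let ?N = "\<lambda>x. L2_set x {..<n}"
  define S where "S = (\<lambda>(x, y). B x y) ` {(x, y). ?N x \<le> 1 \<and> ?N y \<le> 1}"
  define b where "b = Sup S"
  have "B (\<lambda>_. 0) (\<lambda>_. 0) \<in> S" unfolding S_def by (force simp: L2_set_def)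
  then have S0: "0 \<in> S" by (simp add: B_def)
  \<comment> \<open>The supremum must be known to be finite before b/2 can be absorbed; the sum of
    all absolute entries is a sufficient a priori bound.\<close>
  have bdd: "bdd_above S"
  proof (rule bdd_aboveI[of _ "\<Sum>i<n. \<Sum>j<n. \<bar>w i j\<bar>"])
    fix v assume "v \<in> S"
    then obtain x y where v: "v = B x y" "?N x \<le> 1" "?N y \<le> 1" by (auto simp: S_def)
    show "v \<le> (\<Sum>i<n. \<Sum>j<n. \<bar>w i j\<bar>)"
      unfolding v B_def
    proof (intro sum_mono)
      fix i j assume ij: "i \<in> {..<n}" "j \<in> {..<n}"
      have "\<bar>x i\<bar> * \<bar>y j\<bar> \<le> 1"
        using L2_set_le_one_imp_abs_le_one v(2,3) ij by (intro mult_le_one) auto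
      then have "\<bar>w i j\<bar> * (\<bar>x i\<bar> * \<bar>y j\<bar>) \<le> \<bar>w i j\<bar>"
        by (intro mult_left_le) auto
      then have "\<bar>w i j * x i * y j\<bar> \<le> \<bar>w i j\<bar>" by (simp add: abs_mult mult.assoc)
      then show "w i j * x i * y j \<le> \<bar>w i j\<bar>" by linarith
    qed
  qed
  have b0: "0 \<le> b" unfolding b_def by (rule cSup_upper[OF S0 bdd])
  have ball: "B x y \<le> b" if "?N x \<le> 1" "?N y \<le> 1" for x y
    unfolding b_def by (rule cSup_upper[OF _ bdd]) (use that in \<open>auto simp: S_def\<close>)
  have scale: "?N (\<lambda>i. c * x i) = \<bar>c\<bar> * ?N x" for c x
    by (simp add: L2_set_def power_mult_distrib real_sqrt_mult flip: sum_distrib_left)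
  have Bscale: "B (\<lambda>i. c * x i) (\<lambda>i. d * y i) = c * d * B x y" for c d x y
    unfolding B_def sum_distrib_left by (intro sum.cong refl) (simp add: mult_ac)
  have hom: "B x y \<le> b * ?N x * ?N y" for x y
  proof (cases "?N x = 0 \<or> ?N y = 0")
    case True
    then have "(\<forall>i<n. x i = 0) \<or> (\<forall>i<n. y i = 0)" by (auto simp: L2_set_eq_0_iff)
    then have "B x y = 0" by (auto simp: B_def intro!: sum.neutral)
    then show ?thesis using b0 by simp
  next
    case False
    then have pos: "?N x > 0" "?N y > 0" by (simp_all add: order_less_le)
    have "inverse (?N x) * inverse (?N y) * B x y \<le> b"
      unfolding Bscale[symmetric] by (rule ball) (use pos in \<open>simp_all add: scale\<close>)
    then show ?thesis using pos by (simp add: field_simps)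
  qed
  have "v \<le> t + b / 4 + b / 4" if "v \<in> S" for v
  proof -
    from that obtain x y where v: "v = B x y" "?N x \<le> 1" "?N y \<le> 1" by (auto simp: S_def)
    obtain x' where x': "x' \<in> grid n" "?N x' \<le> 1" "?N (\<lambda>i. x i - x' i) \<le> 1 / 4"
      using grid_approximation[OF v(2) n] .
    obtain y' where y': "y' \<in> grid n" "?N y' \<le> 1" "?N (\<lambda>i. y i - y' i) \<le> 1 / 4"
      using grid_approximation[OF v(3) n] .
    \<comment> \<open>Replacing the arguments one at a time leaves one short argument in each error
      term, so homogeneity bounds it by b/4.\<close>
    have "v = B x' y' + B (\<lambda>i. x i - x' i) y + B x' (\<lambda>i. y i - y' i)"
      unfolding v B_def sum.distrib[symmetric] by (intro sum.cong refl) (simp add: algebra_simps)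
    moreover have "B x' y' \<le> t" unfolding B_def by (rule grid) (use x' y' in auto)
    moreover have "b * ?N (\<lambda>i. x i - x' i) * ?N y \<le> b * (1 / 4) * 1"
      by (intro mult_mono mult_nonneg_nonneg) (use b0 x' v in auto)
    moreover have "b * ?N x' * ?N (\<lambda>i. y i - y' i) \<le> b * 1 * (1 / 4)"
      by (intro mult_mono mult_nonneg_nonneg) (use b0 x' y' in auto)
    ultimately show ?thesis
      using hom[of "\<lambda>i. x i - x' i" y] hom[of x' "\<lambda>i. y i - y' i"] by linarith
  qed
  then have "b \<le> t + b / 4 + b / 4"
    unfolding b_def by (intro cSup_least) (use S0 in auto)
  then have b: "b \<le> 2 * t" by simp
  show ?thesis
    unfolding op_bound_def
  proof (intro allI)
    fix x y
    have "b * ?N x * ?N y \<le> 2 * t * ?N x * ?N y"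
      by (intro mult_right_mono b) auto
    then show "(\<Sum>i<n. \<Sum>j<n. w i j * x i * y j) \<le> 2 * t * ?N x * ?N y"
      using hom[of x y] by (simp add: B_def)
  qed
qed

text \<open>A union bound over two families of Gaussian forms: pairs of grid points, with variance
  parameter 1, for the operator norm, and signed basis vectors against \<open>z\<close>, with
  parameter n, for the row sums. As \<open>z\<close> is fixed, the second family needs only 2 n
  events.\<close>

lemma wigner_noise_bounds:
  fixes z :: "nat \<Rightarrow> real" and n :: nat
  assumes n: "16 \<le> n" and z: "\<And>i. i < n \<Longrightarrow> (z i)\<^sup>2 = 1" and t: "0 < t" and L: "0 < L"
  shows "\<exists>A\<in>sets (wigner_space n).
    measure (wigner_space n) A \<ge> 1 - (real (2 * n + 1) ^ (2 * n) * exp (- t\<^sup>2 / 4) + 2 * real n * exp (- L\<^sup>2 / (4 * real n))) \<and>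
    (\<forall>w\<in>A. op_bound n (wigner_entry w) (2 * t) \<and> (\<forall>i<n. \<bar>\<Sum>j<n. wigner_entry w i j * z j\<bar> \<le> L))"
proof -
  interpret W: prob_space "wigner_space n" by (rule prob_space_wigner_space)
  define H where "H = (\<lambda>x y t. {w \<in> space (wigner_space n). t \<le> (\<Sum>i<n. \<Sum>j<n. wigner_entry w i j * x i * y j)})"
  define G where "G = {(x, y). x \<in> grid n \<and> y \<in> grid n \<and> L2_set x {..<n} \<le> 1 \<and> L2_set y {..<n} \<le> 1}"
  \<comment> \<open>c times the i-th basis vector; both signs of c together control the absolute
    value of a row sum.\<close>
  define e where "e = (\<lambda>(i, c) k. if k = (i::nat) then c else (0::real))"
  define I where "I = {..<n} \<times> {1, - 1 :: real}"
  define BG where "BG = (\<Union>(x, y)\<in>G. H x y t)"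
  define BI where "BI = (\<Union>p\<in>I. H (e p) z L)"
  have H: "H x y t \<in> sets (wigner_space n)" for x y t
    unfolding H_def using wigner_bilinear_measurable[of x y n] by measurable
  have Gsub: "G \<subseteq> grid n \<times> grid n" by (auto simp: G_def)
  have finG: "finite G" using Gsub finite_grid by (meson finite_SigmaI finite_subset)
  have "card G \<le> card (grid n \<times> grid n)"
    by (intro card_mono Gsub) (simp add: finite_grid)
  also have "\<dots> \<le> (2 * n + 1) ^ n * (2 * n + 1) ^ n"
    by (simp add: card_cartesian_product mult_mono card_grid_le del: One_nat_def)
  also have "\<dots> = (2 * n + 1) ^ (2 * n)" by (simp add: power_add[symmetric] mult_2)
  finally have cardG: "card G \<le> (2 * n + 1) ^ (2 * n)" .
  have finI: "finite I" and cardI: "card I = 2 * n"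
    by (simp_all add: I_def card_cartesian_product)
  have meas: "BG \<in> sets (wigner_space n)" "BI \<in> sets (wigner_space n)"
    unfolding BG_def BI_def using finG finI H by (auto intro!: sets.finite_UN)
  have "measure (wigner_space n) BG \<le> (\<Sum>p\<in>G. measure (wigner_space n) (case p of (x, y) \<Rightarrow> H x y t))"
    unfolding BG_def using H by (intro W.finite_measure_subadditive_finite finG) auto
  also have "\<dots> \<le> (\<Sum>p\<in>G. exp (- t\<^sup>2 / 4))"
  proof (intro sum_mono)
    fix p assume p: "p \<in> G"
    obtain x y where xy: "p = (x, y)" by (cases p)
    have "(\<Sum>i<n. (x i)\<^sup>2) \<le> 1" "(\<Sum>i<n. (y i)\<^sup>2) \<le> 1"
      using p by (auto simp: xy G_def L2_set_def)
    then have "(\<Sum>i<n. (x i)\<^sup>2) * (\<Sum>i<n. (y i)\<^sup>2) \<le> 1"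
      by (intro mult_le_one) (auto intro: sum_nonneg)
    from wigner_bilinear_tail[OF this _ t]
    show "measure (wigner_space n) (case p of (x, y) \<Rightarrow> H x y t) \<le> exp (- t\<^sup>2 / 4)"
      by (simp add: xy H_def)
  qed
  also have "\<dots> = real (card G) * exp (- t\<^sup>2 / 4)" by simp
  also have "\<dots> \<le> real (2 * n + 1) ^ (2 * n) * exp (- t\<^sup>2 / 4)"
    using of_nat_mono[OF cardG, where 'a = real] by (intro mult_right_mono) auto
  finally have mG: "measure (wigner_space n) BG \<le> real (2 * n + 1) ^ (2 * n) * exp (- t\<^sup>2 / 4)" .
  have "measure (wigner_space n) BI \<le> (\<Sum>p\<in>I. measure (wigner_space n) (H (e p) z L))"
    unfolding BI_def using H by (intro W.finite_measure_subadditive_finite finI) auto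
  also have "\<dots> \<le> (\<Sum>p\<in>I. exp (- L\<^sup>2 / (4 * real n)))"
  proof (intro sum_mono)
    fix p assume p: "p \<in> I"
    then obtain i c where ic: "p = (i, c)" "i < n" "c\<^sup>2 = 1" by (auto simp: I_def)
    have "(\<Sum>k<n. (e p k)\<^sup>2) = (\<Sum>k<n. if k = i then 1 else 0)"
      by (intro sum.cong refl) (simp add: ic e_def)
    then have "(\<Sum>k<n. (e p k)\<^sup>2) = 1" using ic(2) by simp
    moreover have "(\<Sum>k<n. (z k)\<^sup>2) = n" using z by simp
    ultimately have "(\<Sum>k<n. (e p k)\<^sup>2) * (\<Sum>k<n. (z k)\<^sup>2) \<le> n" by simp
    from wigner_bilinear_tail[OF this _ L] n
    show "measure (wigner_space n) (H (e p) z L) \<le> exp (- L\<^sup>2 / (4 * real n))"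
      by (simp add: H_def)
  qed
  also have "\<dots> = 2 * real n * exp (- L\<^sup>2 / (4 * real n))" by (simp add: cardI)
  finally have mI: "measure (wigner_space n) BI \<le> 2 * real n * exp (- L\<^sup>2 / (4 * real n))" .
  show ?thesis
  proof (intro bexI[of _ "space (wigner_space n) - (BG \<union> BI)"] conjI ballI allI impI)
    show "space (wigner_space n) - (BG \<union> BI) \<in> sets (wigner_space n)" using meas by auto
    have "measure (wigner_space n) (BG \<union> BI) \<le> measure (wigner_space n) BG + measure (wigner_space n) BI"
      by (rule measure_Un_le) (use meas in auto)
    then show "measure (wigner_space n) (space (wigner_space n) - (BG \<union> BI))
        \<ge> 1 - (real (2 * n + 1) ^ (2 * n) * exp (- t\<^sup>2 / 4) + 2 * real n * exp (- L\<^sup>2 / (4 * real n)))"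
      using mG mI W.prob_compl[of "BG \<union> BI"] meas by auto
  next
    fix w assume w: "w \<in> space (wigner_space n) - (BG \<union> BI)"
    show "op_bound n (wigner_entry w) (2 * t)"
    proof (rule op_bound_of_grid[OF n])
      fix x y assume "x \<in> grid n" "y \<in> grid n" "L2_set x {..<n} \<le> 1" "L2_set y {..<n} \<le> 1"
      then have "(x, y) \<in> G" by (simp add: G_def)
      then have "w \<notin> H x y t" using w by (auto simp: BG_def)
      then show "(\<Sum>i<n. \<Sum>j<n. wigner_entry w i j * x i * y j) \<le> t" using w by (simp add: H_def)
    qed
    fix i assume i: "i < n"
    have *: "c * (\<Sum>j<n. wigner_entry w i j * z j) < L" if "c \<in> {1, - 1}" for c
    proof -
      have "(i, c) \<in> I" using that i by (auto simp: I_def)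
      then have "w \<notin> H (e (i, c)) z L" using w by (auto simp: BI_def)
      then have "(\<Sum>k<n. \<Sum>j<n. wigner_entry w k j * e (i, c) k * z j) < L" using w by (simp add: H_def)
      also have "(\<Sum>k<n. \<Sum>j<n. wigner_entry w k j * e (i, c) k * z j)
         = (\<Sum>k<n. if k = i then c * (\<Sum>j<n. wigner_entry w i j * z j) else 0)"
        by (intro sum.cong refl) (auto simp: e_def sum_distrib_left mult_ac intro!: sum.cong)
      finally show ?thesis using i by simp
    qed
    from *[of 1] *[of "- 1"] show "\<bar>\<Sum>j<n. wigner_entry w i j * z j\<bar> \<le> L" by auto
  qed
qed

section \<open>Critical points in terms of entries\<close>

text \<open>The entry of \<open>Q * Q\<^sup>T\<close>. Candidates are represented by entry functions
  because function spaces carry the product topology on which the measurability argument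
  rests.\<close>

definition gram :: "(nat \<times> nat \<Rightarrow> real) \<Rightarrow> nat \<Rightarrow> nat \<Rightarrow> real" where
  "gram q i j = q (i, 0) * q (j, 0) + q (i, 1) * q (j, 1)"

definition unit_rows :: "nat \<Rightarrow> (nat \<times> nat \<Rightarrow> real) \<Rightarrow> bool" where
  "unit_rows n q \<longleftrightarrow> (\<forall>i<n. gram q i i = 1)"

definition gram_objective :: "nat \<Rightarrow> (nat \<Rightarrow> nat \<Rightarrow> real) \<Rightarrow> (nat \<times> nat \<Rightarrow> real) \<Rightarrow> real" where
  "gram_objective n a q = (\<Sum>i<n. \<Sum>j<n. a i j * gram q i j)"

text \<open>The Lagrange multiplier of the i-th row constraint, that is, the i-th diagonal entry of
  \<open>A * Q * Q\<^sup>T\<close>.\<close>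

definition multiplier :: "nat \<Rightarrow> (nat \<Rightarrow> nat \<Rightarrow> real) \<Rightarrow> (nat \<times> nat \<Rightarrow> real) \<Rightarrow> nat \<Rightarrow> real" where
  "multiplier n a q i = (\<Sum>j<n. a i j * gram q i j)"

definition critical_entries :: "nat \<Rightarrow> (nat \<Rightarrow> nat \<Rightarrow> real) \<Rightarrow> (nat \<times> nat \<Rightarrow> real) \<Rightarrow> bool" where
  "critical_entries n a q \<longleftrightarrow> unit_rows n q \<and>
     (\<forall>i<n. \<forall>k<2. multiplier n a q i * q (i, k) = (\<Sum>j<n. a i j * q (j, k))) \<and>
     (\<forall>v :: nat \<Rightarrow> real. 0 \<le> (\<Sum>i<n. multiplier n a q i * (v i)\<^sup>2) - (\<Sum>i<n. \<Sum>j<n. a i j * gram q i j * v i * v j))"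

lemma gram_commute: "gram q i j = gram q j i"
  by (simp add: gram_def)

lemma sum_lessThan_2: "(\<Sum>k<(2::nat). f k) = f 0 + (f 1 :: real)"
  by (simp add: numeral_2_eq_2)

context
  fixes n :: nat and a :: "nat \<Rightarrow> nat \<Rightarrow> real" and Q :: "real mat"
  assumes Q: "Q \<in> carrier_mat n 2"
begin

lemma index_mult_transpose: "i < n \<Longrightarrow> j < n \<Longrightarrow> (Q * Q\<^sup>T) $$ (i, j) = gram (\<lambda>p. Q $$ p) i j"
  using Q by (simp add: scalar_prod_def gram_def numeral_2_eq_2)

lemma feasible_iff: "feasible n Q \<longleftrightarrow> unit_rows n (\<lambda>p. Q $$ p)"
  using Q by (simp add: feasible_def unit_rows_def gram_def scalar_prod_def numeral_2_eq_2)

lemma index_mat_mult: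
  "i < n \<Longrightarrow> k < 2 \<Longrightarrow> (mat n n (\<lambda>(i, j). a i j) * Q) $$ (i, k) = (\<Sum>j<n. a i j * Q $$ (j, k))"
  using Q by (simp add: scalar_prod_def atLeast0LessThan)

lemma index_multiplier:
  assumes "i < n"
  shows "(mat n n (\<lambda>(i, j). a i j) * Q * Q\<^sup>T) $$ (i, i) = multiplier n a (\<lambda>p. Q $$ p) i"
proof -
  let ?A = "mat n n (\<lambda>(i, j). a i j)"
  have "(?A * Q * Q\<^sup>T) $$ (i, i) = (\<Sum>k<2. (?A * Q) $$ (i, k) * Q $$ (i, k))"
    using Q assms by (simp del: index_mult_mat(1) add: index_mult_mat(1)[of i "?A * Q"] scalar_prod_def atLeast0LessThan)
  also have "\<dots> = multiplier n a (\<lambda>p. Q $$ p) i"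
    unfolding sum_lessThan_2 multiplier_def gram_def
    by (simp add: index_mat_mult assms sum_distrib_right sum.distrib[symmetric] del: index_mult_mat(1))
      (simp add: algebra_simps)
  finally show ?thesis .
qed

lemma objective_eq: "objective (mat n n (\<lambda>(i, j). a i j)) Q = gram_objective n a (\<lambda>p. Q $$ p)"
proof -
  let ?A = "mat n n (\<lambda>(i, j). a i j)"
  have "Q\<^sup>T * ?A * Q = Q\<^sup>T * (?A * Q)"
    by (rule assoc_mult_mat[of _ 2 n _ n _ 2]) (use Q in auto)
  then have "objective ?A Q = (\<Sum>k<2. \<Sum>i<n. Q $$ (i, k) * (?A * Q) $$ (i, k))"
    using Q unfolding objective_def Defs.trace_def
    by (simp del: index_mult_mat(1) add: index_mult_mat(1)[of _ "Q\<^sup>T"] scalar_prod_def atLeast0LessThan)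
  also have "\<dots> = gram_objective n a (\<lambda>p. Q $$ p)"
    unfolding sum_lessThan_2 gram_objective_def gram_def sum.distrib[symmetric]
    by (intro sum.cong refl) (simp add: index_mat_mult sum_distrib_left sum.distrib[symmetric] algebra_simps del: index_mult_mat(1))
  finally show ?thesis .
qed

lemma second_order_critical_iff:
  assumes sym: "\<And>i j. a i j = a j i"
  shows "second_order_critical n (mat n n (\<lambda>(i, j). a i j)) Q \<longleftrightarrow> critical_entries n a (\<lambda>p. Q $$ p)"
proof -
  let ?A = "mat n n (\<lambda>(i, j). a i j)" and ?q = "\<lambda>p. Q $$ p"
  let ?L = "multiplier n a ?q"
  have D: "ddiag (?A * Q * Q\<^sup>T) = mat n n (\<lambda>(i, j). if i = j then ?L i else 0)"
    using Q index_multiplier by (intro eq_matI) (auto simp: ddiag_def simp del: index_mult_mat(1))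
  have S: "ddiag (?A * Q * Q\<^sup>T) - ?A = mat n n (\<lambda>(i, j). (if i = j then ?L i else 0) - a i j)"
    unfolding D by (intro eq_matI) auto
  have "((ddiag (?A * Q * Q\<^sup>T) - ?A) * Q) $$ (i, k) = ?L i * Q $$ (i, k) - (\<Sum>j<n. a i j * Q $$ (j, k))"
    if "i < n" "k < 2" for i k
  proof -
    have "((ddiag (?A * Q * Q\<^sup>T) - ?A) * Q) $$ (i, k) = (\<Sum>j<n. ((if i = j then ?L i else 0) - a i j) * Q $$ (j, k))"
      unfolding S using Q that by (simp add: scalar_prod_def atLeast0LessThan)
    also have "\<dots> = (\<Sum>j<n. (if i = j then ?L i * Q $$ (i, k) else 0) - a i j * Q $$ (j, k))"
      by (intro sum.cong refl) (auto simp: algebra_simps)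
    also have "\<dots> = ?L i * Q $$ (i, k) - (\<Sum>j<n. a i j * Q $$ (j, k))"
      using that by (simp add: sum_subtractf)
    finally show ?thesis .
  qed
  moreover have "(ddiag (?A * Q * Q\<^sup>T) - ?A) * Q \<in> carrier_mat n 2" unfolding S using Q by auto
  ultimately have first: "(ddiag (?A * Q * Q\<^sup>T) - ?A) * Q = 0\<^sub>m n 2 \<longleftrightarrow>
      (\<forall>i<n. \<forall>k<2. ?L i * Q $$ (i, k) = (\<Sum>j<n. a i j * Q $$ (j, k)))"
    unfolding mat_eq_iff by (auto simp del: index_mult_mat(1))
  let ?m = "\<lambda>i j. (if i = j then ?L i else 0) - a i j * gram ?q i j"
  have M: "ddiag (?A * Q * Q\<^sup>T) - ?A \<odot> (Q * Q\<^sup>T) = mat n n (\<lambda>(i, j). ?m i j)"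
    unfolding D by (intro eq_matI) (auto simp: hadamard_def index_mult_transpose simp del: index_mult_mat(1))
  have form: "vec n v \<bullet> (mat n n (\<lambda>(i, j). ?m i j) *\<^sub>v vec n v)
      = (\<Sum>i<n. ?L i * (v i)\<^sup>2) - (\<Sum>i<n. \<Sum>j<n. a i j * gram ?q i j * v i * v j)" for v
  proof -
    have "vec n v \<bullet> (mat n n (\<lambda>(i, j). ?m i j) *\<^sub>v vec n v) = (\<Sum>i<n. v i * (\<Sum>j<n. ?m i j * v j))"
      by (simp add: scalar_prod_def atLeast0LessThan)
    also have "\<dots> = (\<Sum>i<n. ?L i * (v i)\<^sup>2 - (\<Sum>j<n. a i j * gram ?q i j * v i * v j))"
    proof (intro sum.cong refl)
      fix i assume "i \<in> {..<n}"
      have "v i * (\<Sum>j<n. ?m i j * v j) = (\<Sum>j<n. (if i = j then ?L i * (v i)\<^sup>2 else 0) - a i j * gram ?q i j * v i * v j)"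
        unfolding sum_distrib_left by (intro sum.cong refl) (auto simp: algebra_simps power2_eq_square)
      then show "v i * (\<Sum>j<n. ?m i j * v j) = ?L i * (v i)\<^sup>2 - (\<Sum>j<n. a i j * gram ?q i j * v i * v j)"
        using \<open>i \<in> {..<n}\<close> by (simp add: sum_subtractf)
    qed
    finally show ?thesis by (simp add: sum_subtractf)
  qed
  have "(mat n n (\<lambda>(i, j). ?m i j))\<^sup>T = mat n n (\<lambda>(i, j). ?m i j)"
    by (intro eq_matI) (auto simp: sym[of _ _] gram_commute[of _ _ _])
  moreover have "(\<forall>v \<in> carrier_vec n. 0 \<le> v \<bullet> (mat n n (\<lambda>(i, j). ?m i j) *\<^sub>v v)) \<longleftrightarrow>
      (\<forall>v. 0 \<le> vec n v \<bullet> (mat n n (\<lambda>(i, j). ?m i j) *\<^sub>v vec n v))"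
  proof safe
    fix v :: "real vec" assume "\<forall>v. 0 \<le> vec n v \<bullet> (mat n n (\<lambda>(i, j). ?m i j) *\<^sub>v vec n v)" "v \<in> carrier_vec n"
    then show "0 \<le> v \<bullet> (mat n n (\<lambda>(i, j). ?m i j) *\<^sub>v v)"
      by (metis (no_types, lifting) carrier_vecD eq_vecI dim_vec index_vec)
  qed auto
  ultimately have "psd (ddiag (?A * Q * Q\<^sup>T) - ?A \<odot> (Q * Q\<^sup>T)) \<longleftrightarrow>
      (\<forall>v. 0 \<le> (\<Sum>i<n. ?L i * (v i)\<^sup>2) - (\<Sum>i<n. \<Sum>j<n. a i j * gram ?q i j * v i * v j))"
    unfolding M psd_def form by simp
  then show ?thesis
    unfolding second_order_critical_def critical_entries_def first feasible_iff by simp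
qed

end

section \<open>Reduction of the quantifiers to a compact box\<close>

lemma gram_cong: "i < n \<Longrightarrow> j < n \<Longrightarrow> gram (\<lambda>p. mat n 2 q $$ p) i j = gram q i j"
  by (simp add: gram_def)

text \<open>Restricting the entries to \<open>[-1, 1]\<close> is harmless for matrices with unit rows, and makes the domain
  of the quantifiers compact.\<close>

lemma unit_rows_compact_entries:
  assumes Q: "Q \<in> carrier_mat n 2" and u: "unit_rows n (\<lambda>p. Q $$ p)"
  obtains q where "\<And>p. q p \<in> {-1..1 :: real}" "Q = mat n 2 q"
proof -
  define q where "q = (\<lambda>(i, k). if i < n \<and> k < 2 then Q $$ (i, k) else 0)"
  have "\<bar>Q $$ (i, k)\<bar> \<le> 1" if "i < n" "k < 2" for i k
  proof -
    have "(Q $$ (i, 0))\<^sup>2 + (Q $$ (i, 1))\<^sup>2 = 1"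
      using u that by (simp add: unit_rows_def gram_def power2_eq_square)
    then have eq: "(Q $$ (i, 0))\<^sup>2 = 1 - (Q $$ (i, 1))\<^sup>2" by simp
    have "(Q $$ (i, k))\<^sup>2 \<le> 1\<^sup>2"
    proof -
      have "k = 0 \<or> k = 1" using that(2) by auto
      then show ?thesis
      proof
        assume "k = 0"
        then show ?thesis by (simp add: eq)
      next
        assume "k = 1"
        then show ?thesis using eq zero_le_power2[of "Q $$ (i, 0)"] by simp
      qed
    qed
    then show ?thesis using abs_le_square_iff[of "Q $$ (i, k)" 1] by simp
  qed
  then have "q p \<in> {-1..1}" for p
    by (cases p) (auto simp: q_def abs_le_iff minus_le_iff)
  moreover have "Q = mat n 2 q" using Q by (intro eq_matI) (auto simp: q_def)
  ultimately show thesis by (rule that)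
qed

lemma critical_entries_cong:
  assumes "\<And>i k. i < n \<Longrightarrow> k < 2 \<Longrightarrow> q (i, k) = q' (i, k)"
  shows "critical_entries n a q \<longleftrightarrow> critical_entries n a q'"
proof -
  have g: "gram q i j = gram q' i j" if "i < n" "j < n" for i j
    using assms that by (simp add: gram_def)
  have m: "multiplier n a q i = multiplier n a q' i" if "i < n" for i
    unfolding multiplier_def using g that by simp
  have "(\<Sum>i<n. \<Sum>j<n. a i j * gram q i j * v i * v j) = (\<Sum>i<n. \<Sum>j<n. a i j * gram q' i j * v i * v j)" for v
    using g by simp
  moreover have "(\<Sum>i<n. multiplier n a q i * (v i)\<^sup>2) = (\<Sum>i<n. multiplier n a q' i * (v i)\<^sup>2)" for v
    using m by simp
  moreover have "unit_rows n q \<longleftrightarrow> unit_rows n q'"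
    using g by (simp add: unit_rows_def)
  moreover have "(\<Sum>j<n. a i j * q (j, k)) = (\<Sum>j<n. a i j * q' (j, k))" if "k < 2" for i k
    using assms that by simp
  ultimately show ?thesis
    unfolding critical_entries_def using assms m by simp
qed

lemma gram_objective_cong:
  assumes "\<And>i j. i < n \<Longrightarrow> j < n \<Longrightarrow> gram q i j = gram q' i j"
  shows "gram_objective n a q = gram_objective n a q'"
  unfolding gram_objective_def using assms by simp

text \<open>Every index is constrained, including those outside the n by 2 block, so that the set is
  compact in the full function space and serves all n.\<close>

definition unit_box :: "(nat \<times> nat \<Rightarrow> real) set" where
  "unit_box = {q. \<forall>p. q p \<in> {-1..1}}"

text \<open>The critical point and its competitor are both quantified over the box at the front, so
  that failure means the existence of a bad pair in a compact set.\<close>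

lemma critical_points_optimal_iff:
  fixes z :: "real vec"
  assumes sym: "\<And>i j. a i j = a j i" and z: "z \<in> carrier_vec n"
  defines "Y \<equiv> mat n n (\<lambda>(i, j). a i j)"
  shows "(\<forall>Q. second_order_critical n Y Q \<longrightarrow> global_optimum n Y Q \<and> Q * Q\<^sup>T = outer z) \<longleftrightarrow>
    (\<forall>q\<in>unit_box. \<forall>q'\<in>unit_box. critical_entries n a q \<longrightarrow> unit_rows n q' \<longrightarrow>
       gram_objective n a q' \<le> gram_objective n a q \<and> (\<forall>i<n. \<forall>j<n. gram q i j = z $ i * z $ j))"
    (is "?L \<longleftrightarrow> ?R")
proof -
  have carr: "mat n 2 q \<in> carrier_mat n 2" for q by simp
  have outer: "Q * Q\<^sup>T = outer z \<longleftrightarrow> (\<forall>i<n. \<forall>j<n. gram (\<lambda>p. Q $$ p) i j = z $ i * z $ j)"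
    if Q: "Q \<in> carrier_mat n 2" for Q
    using Q z index_mult_transpose[OF Q] by (auto simp: mat_eq_iff outer_def simp del: index_mult_mat(1))
  have crit: "second_order_critical n Y (mat n 2 q) \<longleftrightarrow> critical_entries n a q" for q
    unfolding Y_def second_order_critical_iff[where a = a, OF carr sym] by (rule critical_entries_cong) simp
  have obj: "objective Y (mat n 2 q) = gram_objective n a q" for q
    unfolding Y_def objective_eq[OF carr] by (rule gram_objective_cong) (rule gram_cong)
  have feas: "feasible n (mat n 2 q) \<longleftrightarrow> unit_rows n q" for q
    unfolding feasible_iff[OF carr] by (simp add: unit_rows_def gram_cong)
  have out: "mat n 2 q * (mat n 2 q)\<^sup>T = outer z \<longleftrightarrow> (\<forall>i<n. \<forall>j<n. gram q i j = z $ i * z $ j)" for q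
    unfolding outer[OF carr] by (simp add: gram_cong)
  have box: "\<exists>q\<in>unit_box. Q = mat n 2 q" if "feasible n Q" for Q
  proof -
    have Q: "Q \<in> carrier_mat n 2" using that by (simp add: feasible_def)
    have u: "unit_rows n (\<lambda>p. Q $$ p)" using that feasible_iff[OF Q] by simp
    show ?thesis
      by (rule unit_rows_compact_entries[OF Q u]) (unfold unit_box_def, blast)
  qed
  \<comment> \<open>This makes q' = q an admissible competitor, which frees the Gram identity in
    \<open>?R\<close> from its hypothesis on q'.\<close>
  have critu: "critical_entries n a q \<Longrightarrow> unit_rows n q" for q by (simp add: critical_entries_def)
  show ?thesis
  proof
    assume L: ?L
    show ?R
    proof (intro ballI impI)
      fix q q' assume "critical_entries n a q" "unit_rows n q'"
      then show "gram_objective n a q' \<le> gram_objective n a q \<and> (\<forall>i<n. \<forall>j<n. gram q i j = z $ i * z $ j)"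
        using L[rule_format, of "mat n 2 q"] unfolding crit out global_optimum_def
        by (metis feas obj)
    qed
  next
    assume R: ?R
    show ?L
    proof (intro allI impI)
      fix Q assume Q: "second_order_critical n Y Q"
      then have "feasible n Q" by (simp add: second_order_critical_def)
      then obtain q where q: "q \<in> unit_box" "Q = mat n 2 q" using box by blast
      have c: "critical_entries n a q" using Q by (simp add: q crit)
      have "objective Y Q' \<le> objective Y Q" if Q': "feasible n Q'" for Q'
      proof -
        obtain q' where q': "q' \<in> unit_box" "Q' = mat n 2 q'" using box Q' by blast
        then show ?thesis using R q c Q' by (simp add: obj feas)
      qed
      then show "global_optimum n Y Q \<and> Q * Q\<^sup>T = outer z"
        using R q c critu[OF c] by (simp add: global_optimum_def feas out)
    qed
  qed
qed

section \<open>Measurability of the event\<close>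

text \<open>The tube lemma: projection along a compact factor is a closed map.\<close>

lemma closed_projection_along_compact:
  fixes S :: "('a::topological_space \<times> 'b::topological_space) set"
  assumes "compact K" "closed S"
  shows "closed {x. \<exists>y\<in>K. (x, y) \<in> S}"
proof -
  have "closed_map (prod_topology euclidean (top_of_set K)) (euclidean :: 'a topology) fst"
    using assms(1) by (intro Abstract_Topological_Spaces.closed_map_fst) (simp add: compact_space_subtopology)
  moreover have "closedin (prod_topology euclidean (top_of_set K)) (S \<inter> UNIV \<times> K)"
    using assms(2) by (auto simp: prod_topology_subtopology closedin_subtopology)
  ultimately have "closed (fst ` (S \<inter> UNIV \<times> K))"
    by (auto simp: closed_map_def)
  also have "fst ` (S \<inter> UNIV \<times> K) = {x. \<exists>y\<in>K. (x, y) \<in> S}" by force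
  finally show ?thesis .
qed

lemma compact_unit_box: "compact unit_box"
proof -
  have "compactin (product_topology (\<lambda>_. euclidean) UNIV) (PiE UNIV (\<lambda>_. {-1..1 :: real}))"
    unfolding compactin_PiE by simp
  also have "PiE UNIV (\<lambda>_. {-1..1 :: real}) = unit_box" by (auto simp: unit_box_def PiE_def)
  finally show ?thesis by (simp add: euclidean_product_topology)
qed

text \<open>This lets closed sets of the full function space be pulled back to events.\<close>

lemma wigner_space_measurable_id: "(\<lambda>w. w) \<in> borel_measurable (wigner_space n)"
proof (rule measurable_coordinatewise_then_product)
  fix p :: "nat \<times> nat"
  show "(\<lambda>w. w p) \<in> borel_measurable (wigner_space n)"
  proof (cases "p \<in> below_diag n")
    case True
    then show ?thesis unfolding wigner_space_def by measurable
  next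
    \<comment> \<open>Sample points are extensional, so this coordinate is the constant
      \<open>undefined\<close>.\<close>
    case False
    then have "(\<lambda>w. w p) \<in> borel_measurable (wigner_space n) \<longleftrightarrow>
        (\<lambda>w. undefined :: real) \<in> borel_measurable (wigner_space n)"
      by (intro measurable_cong) (auto simp: wigner_space_def space_PiM intro: PiE_arb)
    then show ?thesis by simp
  qed
qed

definition signal_entry :: "(nat \<Rightarrow> real) \<Rightarrow> real \<Rightarrow> (nat \<times> nat \<Rightarrow> real) \<Rightarrow> nat \<Rightarrow> nat \<Rightarrow> real" where
  "signal_entry z s w i j = z i * z j + s * wigner_entry w i j"

section \<open>Continuity and closedness, jointly in the noise and the candidate\<close>

lemma continuous_on_signal_entry:
  assumes "continuous_on S f"
  shows "continuous_on S (\<lambda>x. signal_entry z s (f x) i j)"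
proof -
  note c = continuous_on_product_then_coordinatewise[OF assms]
  show ?thesis
    unfolding signal_entry_def wigner_entry_def
    by (cases "j < i"; cases "i < j"; simp; intro continuous_intros c)
qed

lemma continuous_on_gram:
  assumes "continuous_on S f"
  shows "continuous_on S (\<lambda>x. gram (f x) i j)"
proof -
  note c = continuous_on_product_then_coordinatewise[OF assms]
  show ?thesis unfolding gram_def by (intro continuous_on_add continuous_on_mult c)
qed

lemma continuous_on_gram_objective:
  "continuous_on S f \<Longrightarrow> continuous_on S g \<Longrightarrow> continuous_on S (\<lambda>x. gram_objective n (signal_entry z s (f x)) (g x))"
  unfolding gram_objective_def
  by (intro continuous_on_sum continuous_on_mult continuous_on_signal_entry continuous_on_gram)

lemma continuous_on_multiplier:
  "continuous_on S f \<Longrightarrow> continuous_on S g \<Longrightarrow> continuous_on S (\<lambda>x. multiplier n (signal_entry z s (f x)) (g x) i)"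
  unfolding multiplier_def
  by (intro continuous_on_sum continuous_on_mult continuous_on_signal_entry continuous_on_gram)

lemma closed_unit_rows:
  assumes "continuous_on UNIV f"
  shows "closed {x. unit_rows n (f x)}"
  unfolding unit_rows_def
  by (intro closed_Collect_all closed_Collect_imp open_Collect_const closed_Collect_eq
      continuous_on_gram continuous_on_const assms)

text \<open>All conditions are equalities or weak inequalities between continuous functions; the
  quantifier over test vectors is an arbitrary intersection of closed sets.\<close>

lemma closed_critical_entries:
  assumes f: "continuous_on UNIV f" and g: "continuous_on UNIV g"
  shows "closed {x. critical_entries n (signal_entry z s (f x)) (g x)}"
proof -
  note cont = continuous_on_product_then_coordinatewise[OF g] continuous_on_multiplier[OF f g]
    continuous_on_signal_entry[OF f] continuous_on_gram[OF g]
    continuous_on_add continuous_on_diff continuous_on_mult continuous_on_sum continuous_on_const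
  show ?thesis
    unfolding critical_entries_def
    by (intro closed_Collect_conj closed_unit_rows[OF g] closed_Collect_all closed_Collect_imp open_Collect_const
        closed_Collect_eq closed_Collect_le cont)
qed

text \<open>The complement of the event is a countable union of projections of closed sets along a compact
  set; this matters since \<^const>\<open>measure\<close> is \<open>0\<close> on non-measurable sets.\<close>

lemma critical_points_event_measurable:
  "{w \<in> space (wigner_space n). \<forall>q\<in>unit_box. \<forall>q'\<in>unit_box. critical_entries n (signal_entry z s w) q \<longrightarrow>
      unit_rows n q' \<longrightarrow> gram_objective n (signal_entry z s w) q' \<le> gram_objective n (signal_entry z s w) q \<and>
      (\<forall>i<n. \<forall>j<n. gram q i j = z i * z j)} \<in> sets (wigner_space n)"
  (is "?E \<in> _")
proof -
  let ?a = "signal_entry z s"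
  \<comment> \<open>A continuous measure of violation, positive exactly when the conclusion fails
    for q and q'.\<close>
  define h where "h = (\<lambda>w q q'. (\<Sum>i<n. \<Sum>j<n. (gram q i j - z i * z j)\<^sup>2)
      + max 0 (gram_objective n (?a w) q' - gram_objective n (?a w) q))"
  \<comment> \<open>The set where \<open>h\<close> is positive need not be closed; it is exhausted
    by the closed sets where \<open>h\<close> is at least 1 / (k + 1).\<close>
  define S where "S = (\<lambda>k. {(w, q, q'). critical_entries n (?a w) q \<and> unit_rows n q' \<and> inverse (real (Suc k)) \<le> h w q q'})"
  define B where "B = (\<lambda>k. {w. \<exists>y\<in>unit_box \<times> unit_box. (w, y) \<in> S k})"
  have "closed (S k)" for k
    unfolding S_def case_prod_beta' h_def
    by (intro closed_Collect_conj closed_unit_rows closed_critical_entries closed_Collect_le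
        continuous_on_add continuous_on_diff continuous_on_power continuous_on_sum continuous_on_const continuous_on_max
        continuous_on_gram continuous_on_gram_objective continuous_on_fst continuous_on_snd continuous_on_id)
  then have "closed (B k)" for k
    unfolding B_def by (intro closed_projection_along_compact compact_Times compact_unit_box)
  then have Bk: "(\<lambda>w. w) -` B k \<inter> space (wigner_space n) \<in> sets (wigner_space n)" for k
    by (intro measurable_sets[OF wigner_space_measurable_id] borel_closed)
  have h_nonneg: "0 \<le> (\<Sum>i<n. \<Sum>j<n. (gram q i j - z i * z j)\<^sup>2)" for q
    by (intro sum_nonneg) simp
  have h_pos: "0 < h w q q' \<longleftrightarrow>
      \<not> (gram_objective n (?a w) q' \<le> gram_objective n (?a w) q \<and> (\<forall>i<n. \<forall>j<n. gram q i j = z i * z j))" for w q q'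
  proof -
    have "(\<Sum>i<n. \<Sum>j<n. (gram q i j - z i * z j)\<^sup>2) = 0 \<longleftrightarrow> (\<forall>i<n. \<forall>j<n. gram q i j = z i * z j)"
      by (auto simp: sum_nonneg_eq_0_iff sum_nonneg)
    then show ?thesis using h_nonneg[of q] unfolding h_def by (auto simp: max_def not_le less_le)
  qed
  have E: "?E = space (wigner_space n) - (\<Union>k. (\<lambda>w. w) -` B k \<inter> space (wigner_space n))"
  proof (intro subset_antisym subsetI)
    fix w assume w: "w \<in> ?E"
    have "w \<notin> B k" for k
    proof
      assume "w \<in> B k"
      then obtain q q' where q: "q \<in> unit_box" "q' \<in> unit_box" "critical_entries n (?a w) q" "unit_rows n q'"
        "inverse (real (Suc k)) \<le> h w q q'" by (auto simp: B_def S_def)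
      then have "0 < h w q q'" by (meson inverse_positive_iff_positive less_le_trans of_nat_0_less_iff zero_less_Suc)
      then show False using w q(1-4) unfolding h_pos by blast
    qed
    then show "w \<in> space (wigner_space n) - (\<Union>k. (\<lambda>w. w) -` B k \<inter> space (wigner_space n))"
      using w by auto
  next
    fix w assume w: "w \<in> space (wigner_space n) - (\<Union>k. (\<lambda>w. w) -` B k \<inter> space (wigner_space n))"
    have "\<not> 0 < h w q q'"
      if q: "q \<in> unit_box" "q' \<in> unit_box" "critical_entries n (?a w) q" "unit_rows n q'" for q q'
    proof
      assume "0 < h w q q'"
      then obtain k where "inverse (real (Suc k)) < h w q q'" using reals_Archimedean by blast
      then have "w \<in> B k" using q by (force simp: B_def S_def)
      then show False using w by auto
    qed
    then show "w \<in> ?E" using w unfolding h_pos by blast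
  qed
  have "(\<Union>k. (\<lambda>w. w) -` B k \<inter> space (wigner_space n)) \<in> sets (wigner_space n)"
    by (rule sets.countable_UN) (use Bk in blast)
  then show ?thesis unfolding E by (rule sets.Diff[OF sets.top])
qed

section \<open>Exactness of the relaxation\<close>

lemma wigner_entry_commute: "wigner_entry w i j = wigner_entry w j i"
  by (auto simp: wigner_entry_def)

text \<open>Conjugation by the signs \<open>z\<close> turns the signal into the all-ones matrix and
  keeps the noise bounds. Critical points then have constant rows, and such points attain the upper
  bound given by the dual certificate.\<close>

lemma critical_points_optimal_of_noise_bounds:
  fixes z :: "nat \<Rightarrow> real" and w :: "nat \<times> nat \<Rightarrow> real" and n :: nat
  defines "W \<equiv> wigner_entry w"
  assumes z: "\<And>i. i < n \<Longrightarrow> (z i)\<^sup>2 = 1"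
    and op: "op_bound n W K" and K: "0 \<le> K" and s: "0 \<le> s"
    and row: "\<And>i. i < n \<Longrightarrow> \<bar>\<Sum>j<n. W i j * z j\<bar> \<le> L"
    and sK: "s * K < real n / 8"
    and sL: "s * L + 4 * (s * K)\<^sup>2 / sqrt n \<le> real n / 4"
    and crit: "critical_entries n (signal_entry z s w) q"
  shows "\<And>i j. i < n \<Longrightarrow> j < n \<Longrightarrow> gram q i j = z i * z j"
    and "unit_rows n q' \<Longrightarrow> gram_objective n (signal_entry z s w) q' \<le> gram_objective n (signal_entry z s w) q"
proof -
  let ?a = "signal_entry z s w"
  define w' where "w' = (\<lambda>i j. z i * z j * W i j)"
  have op': "op_bound n w' K" unfolding w'_def by (rule op_bound_conjugate[OF op z])
  have sym': "w' i j = w' j i" for i j by (simp add: w'_def W_def wigner_entry_commute[of w i])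
  have diag': "w' i i = 0" for i by (simp add: w'_def W_def wigner_entry_def)
  have row': "\<bar>\<Sum>j<n. w' i j\<bar> \<le> L" if i: "i < n" for i
  proof -
    have "(\<Sum>j<n. w' i j) = z i * (\<Sum>j<n. W i j * z j)"
      unfolding w'_def sum_distrib_left by (intro sum.cong refl) (simp add: mult_ac)
    moreover have "\<bar>z i\<bar> = 1" using z[OF i] by (auto simp: power2_eq_1_iff)
    ultimately show ?thesis using row[OF i] by (simp add: abs_mult)
  qed
  have zz: "z i * (z i * c) = c" if "i < n" for i c
    using z[OF that] by (simp add: power2_eq_square flip: mult.assoc)
  have conj: "(1 + s * w' i j) = z i * z j * ?a i j" if "i < n" "j < n" for i j
    using that by (simp add: w'_def W_def signal_entry_def algebra_simps zz z power2_eq_square[symmetric])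
  have gconj: "?a i j * gram q i j = (1 + s * w' i j) * ((z i * q (i, 0)) * (z j * q (j, 0)) + (z i * q (i, 1)) * (z j * q (j, 1)))"
    if "i < n" "j < n" for i j q
    using that by (simp add: conj gram_def algebra_simps zz)
  let ?x = "\<lambda>i. z i * q (i, 0)" and ?y = "\<lambda>i. z i * q (i, 1)"
  have mult: "(\<Sum>j<n. (1 + s * w' i j) * (?x i * ?x j + ?y i * ?y j)) = multiplier n ?a q i" if "i < n" for i
    unfolding multiplier_def by (intro sum.cong refl) (use that in \<open>simp add: gconj\<close>)
  have "unit_rows n q" using crit by (simp add: critical_entries_def)
  then have unit: "(?x i)\<^sup>2 + (?y i)\<^sup>2 = 1" if "i < n" for i
    using that z[OF that] by (simp add: unit_rows_def gram_def power_mult_distrib) (simp add: power2_eq_square)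
  have first: "(\<Sum>j<n. (1 + s * w' i j) * (?x i * ?x j + ?y i * ?y j)) * (z i * q (i, k)) = (\<Sum>j<n. (1 + s * w' i j) * (z j * q (j, k)))"
    if "i < n" "k < 2" for i k
  proof -
    have "multiplier n ?a q i * q (i, k) = (\<Sum>j<n. ?a i j * q (j, k))"
      using crit that by (simp add: critical_entries_def)
    then have "multiplier n ?a q i * (z i * q (i, k)) = z i * (\<Sum>j<n. ?a i j * q (j, k))"
      by (simp add: mult.left_commute[of _ "z i"])
    also have "\<dots> = (\<Sum>j<n. (1 + s * w' i j) * (z j * q (j, k)))"
      unfolding sum_distrib_left
      by (intro sum.cong refl) (use that in \<open>simp add: conj mult_ac zz\<close>)
    finally show ?thesis unfolding mult[OF that(1)] .
  qed
  have quad: "0 \<le> (\<Sum>i<n. (\<Sum>j<n. (1 + s * w' i j) * (?x i * ?x j + ?y i * ?y j)) * (v i)\<^sup>2)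
      - (\<Sum>i<n. \<Sum>j<n. (1 + s * w' i j) * (?x i * ?x j + ?y i * ?y j) * v i * v j)" for v
  proof -
    have "0 \<le> (\<Sum>i<n. multiplier n ?a q i * (v i)\<^sup>2) - (\<Sum>i<n. \<Sum>j<n. ?a i j * gram q i j * v i * v j)"
      using crit by (simp add: critical_entries_def)
    also have "\<dots> = (\<Sum>i<n. (\<Sum>j<n. (1 + s * w' i j) * (?x i * ?x j + ?y i * ?y j)) * (v i)\<^sup>2)
      - (\<Sum>i<n. \<Sum>j<n. (1 + s * w' i j) * (?x i * ?x j + ?y i * ?y j) * v i * v j)"
      by (intro arg_cong2[of _ _ _ _ "(-)"] sum.cong refl) (simp_all only: mult gconj lessThan_iff)
    finally show ?thesis .
  qed
  have k: "(0::nat) < 2" "(1::nat) < 2" by simp_all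
  have ones: "?x i * ?x j + ?y i * ?y j = 1" if "i < n" "j < n" for i j
    by (rule critical_point_ones[OF op' K s diag' row' sK sL unit first[OF _ k(1)] first[OF _ k(2)] quad that])
  show gram: "gram q i j = z i * z j" if "i < n" "j < n" for i j
  proof -
    have "gram q i j = z i * z j * (?x i * ?x j + ?y i * ?y j)"
      using that by (simp add: gram_def algebra_simps zz)
    then show ?thesis using ones[OF that] by simp
  qed
  assume u': "unit_rows n q'"
  let ?x' = "\<lambda>i. z i * q' (i, 0)" and ?y' = "\<lambda>i. z i * q' (i, 1)"
  have unit': "(?x' i)\<^sup>2 + (?y' i)\<^sup>2 = 1" if "i < n" for i
    using u' that z[OF that] by (simp add: unit_rows_def gram_def power_mult_distrib) (simp add: power2_eq_square)
  have sKL: "s * L + s * K \<le> n"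
  proof -
    have "0 \<le> 4 * (s * K)\<^sup>2 / sqrt n" by simp
    then show ?thesis using sK sL by linarith
  qed
  have cert: "(\<Sum>i<n. \<Sum>j<n. (1 + s * w' i j) * x i * x j) \<le> (\<Sum>i<n. \<Sum>j<n. (1 + s * w' i j) * (x i)\<^sup>2)" for x
    by (rule ones_certificate[OF op' s sym' row' sKL])
  \<comment> \<open>The objective splits over the two columns. The certificate bounds each, and unit
    rows merge the diagonal terms into the sum of all entries, which is the value at q.\<close>
  have "gram_objective n ?a q' = (\<Sum>i<n. \<Sum>j<n. (1 + s * w' i j) * ?x' i * ?x' j) + (\<Sum>i<n. \<Sum>j<n. (1 + s * w' i j) * ?y' i * ?y' j)"
    unfolding gram_objective_def sum.distrib[symmetric]
    by (intro sum.cong refl) (simp add: gconj distrib_left mult.assoc)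
  also have "\<dots> \<le> (\<Sum>i<n. \<Sum>j<n. (1 + s * w' i j) * (?x' i)\<^sup>2) + (\<Sum>i<n. \<Sum>j<n. (1 + s * w' i j) * (?y' i)\<^sup>2)"
    by (intro add_mono cert)
  also have "\<dots> = (\<Sum>i<n. \<Sum>j<n. (1 + s * w' i j))"
    unfolding sum.distrib[symmetric]
    by (intro sum.cong refl) (use unit' in \<open>simp flip: distrib_left\<close>)
  also have "\<dots> = gram_objective n ?a q"
    unfolding gram_objective_def by (intro sum.cong refl) (simp add: conj gram mult_ac)
  finally show "gram_objective n ?a q' \<le> gram_objective n ?a q" .
qed

lemma observation_eq:
  assumes "z \<in> carrier_vec n"
  shows "observation z s (wigner n w) = mat n n (\<lambda>(i, j). signal_entry (\<lambda>i. z $ i) s w i j)"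
  using assms by (intro eq_matI) (auto simp: observation_def outer_def wigner_def signal_entry_def wigner_entry_def)

theorem theorem4:
  shows "\<exists>C>0. \<forall>(z :: nat \<Rightarrow> real vec) (lambda :: nat \<Rightarrow> real).
    (\<forall>n\<ge>1. z n \<in> carrier_vec n \<and> (\<forall>i<n. z n $ i \<in> {-1, 1})) \<longrightarrow>
    (\<forall>n\<ge>1. lambda n \<ge> C * real n powr (1/3)) \<longrightarrow>
    (\<lambda>n. measure (wigner_space n)
       {w \<in> space (wigner_space n).
          let Y = observation (z n) (sqrt (real n) / lambda n) (wigner n w)
          in \<forall>Q. second_order_critical n Y Q \<longrightarrow>
               global_optimum n Y Q \<and> Q * Q\<^sup>T = outer (z n)})
      \<longlonglongrightarrow> 1"
proof (intro exI[of _ "1::real"] conjI allI impI)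
  \<comment> \<open>The constant C = 1 suffices because the conditions below hold with a power of n
    to spare.\<close>
  fix z :: "nat \<Rightarrow> real vec" and lambda :: "nat \<Rightarrow> real"
  assume z: "\<forall>n\<ge>1. z n \<in> carrier_vec n \<and> (\<forall>i<n. z n $ i \<in> {-1, 1})"
    and lambda: "\<forall>n\<ge>1. lambda n \<ge> 1 * real n powr (1/3)"
  define E where "E = (\<lambda>n. {w \<in> space (wigner_space n).
      let Y = observation (z n) (sqrt (real n) / lambda n) (wigner n w)
      in \<forall>Q. second_order_critical n Y Q \<longrightarrow> global_optimum n Y Q \<and> Q * Q\<^sup>T = outer (z n)})"
  \<comment> \<open>With \<open>s \<le> n powr (1/6)\<close>, any exponent strictly between \<open>1/2\<close> and \<open>7/12\<close> works for the operator norm,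
    and any strictly between \<open>1/2\<close> and \<open>5/6\<close> for the row sums.\<close>
  define \<epsilon> where "\<epsilon> = (\<lambda>n. real (2 * n + 1) ^ (2 * n) * exp (- (real n powr (13/24))\<^sup>2 / 4)
      + 2 * real n * exp (- (real n powr (3/4))\<^sup>2 / (4 * real n)))"
  \<comment> \<open>The first term has exponent 2 n log (2 n + 1) - n^(13/12)/4; the second is 2 n
    exp (- sqrt n / 4).\<close>
  have "\<epsilon> \<longlonglongrightarrow> 0" unfolding \<epsilon>_def by real_asymp
  then have lim: "(\<lambda>n. 1 - \<epsilon> n) \<longlonglongrightarrow> 1" using tendsto_diff[of "\<lambda>_. 1" 1 _ \<epsilon> 0] by simp
  have sK: "\<forall>\<^sub>F n in sequentially. real n powr (1/6) * (2 * real n powr (13/24)) < real n / 8"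
    by real_asymp
  \<comment> \<open>The quadratic term sets the limit 7/12: with s of order n^(1/6) and K of order
    n^(7/12) it would be of order n.\<close>
  have sL: "\<forall>\<^sub>F n in sequentially. real n powr (1/6) * real n powr (3/4)
      + 4 * (real n powr (1/6) * (2 * real n powr (13/24)))\<^sup>2 / sqrt n \<le> real n / 4"
    by real_asymp
  have "\<forall>\<^sub>F n in sequentially. 1 - \<epsilon> n \<le> measure (wigner_space n) (E n)"
    using eventually_ge_at_top[of 16] sK sL
  proof eventually_elim
    case (elim n)
    interpret W: prob_space "wigner_space n" by (rule prob_space_wigner_space)
    let ?s = "sqrt (real n) / lambda n" and ?z = "\<lambda>i. z n $ i" and ?K = "2 * real n powr (13/24)" and ?L = "real n powr (3/4)"
    have n: "16 \<le> n" "real n > 0" using elim(1) by auto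
    have zn: "z n \<in> carrier_vec n" using z n by simp
    have "\<forall>i<n. ?z i \<in> {-1, 1}" using z n(1) by simp
    then have z2: "(?z i)\<^sup>2 = 1" if "i < n" for i using that by (auto simp: power2_eq_1_iff)
    have l: "real n powr (1/3) \<le> lambda n" using lambda n by simp
    have l0: "0 < real n powr (1/3)" using n by simp
    have s0: "0 \<le> ?s" using order_less_le_trans[OF l0 l] by simp
    have "?s \<le> sqrt (real n) / real n powr (1/3)"
      by (intro divide_left_mono l mult_pos_pos l0 order_less_le_trans[OF l0 l]) simp
    also have "\<dots> = real n powr (1/6)"
      using n by (simp add: powr_half_sqrt[symmetric] powr_diff[symmetric])
    finally have s: "?s \<le> real n powr (1/6)" .
    have "?s * ?K \<le> real n powr (1/6) * ?K" using s by (intro mult_right_mono) auto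
    then have sK: "?s * ?K < real n / 8" using elim(2) by linarith
    have "?s * ?L + 4 * (?s * ?K)\<^sup>2 / sqrt n \<le> real n powr (1/6) * ?L + 4 * (real n powr (1/6) * ?K)\<^sup>2 / sqrt n"
      using mult_nonneg_nonneg[OF s0, of ?K] s
      by (intro add_mono divide_right_mono mult_left_mono mult_right_mono power_mono)
        (auto simp del: times_divide_eq_left)
    then have sL: "?s * ?L + 4 * (?s * ?K)\<^sup>2 / sqrt n \<le> real n / 4" using elim(3) by linarith
    have pos: "0 < real n powr (13/24)" "0 < ?L" using n by simp_all
    obtain A where A: "A \<in> sets (wigner_space n)"
      "measure (wigner_space n) A \<ge> 1 - \<epsilon> n"
      and noise: "\<forall>w\<in>A. op_bound n (wigner_entry w) ?K \<and> (\<forall>i<n. \<bar>\<Sum>j<n. wigner_entry w i j * ?z j\<bar> \<le> ?L)"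
      using wigner_noise_bounds[where n = n and z = ?z, OF n(1) z2 pos] unfolding \<epsilon>_def by blast
    have E: "E n = {w \<in> space (wigner_space n). \<forall>q\<in>unit_box. \<forall>q'\<in>unit_box.
        critical_entries n (signal_entry ?z ?s w) q \<longrightarrow> unit_rows n q' \<longrightarrow>
        gram_objective n (signal_entry ?z ?s w) q' \<le> gram_objective n (signal_entry ?z ?s w) q \<and>
        (\<forall>i<n. \<forall>j<n. gram q i j = ?z i * ?z j)}"
    proof -
      have "signal_entry ?z ?s w i j = signal_entry ?z ?s w j i" for w i j
        by (simp add: signal_entry_def wigner_entry_commute[of w i] mult.commute)
      from critical_points_optimal_iff[OF this zn] show ?thesis
        unfolding E_def Let_def observation_eq[OF zn] by simp
    qed
    have "A \<subseteq> E n"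
    proof
      fix w assume w: "w \<in> A"
      have "w \<in> space (wigner_space n)" using w A(1) sets.sets_into_space by blast
      have op: "op_bound n (wigner_entry w) ?K" using noise w by blast
      have row: "\<bar>\<Sum>j<n. wigner_entry w i j * ?z j\<bar> \<le> ?L" if "i < n" for i
        using noise w that by blast
      note critical_points_optimal_of_noise_bounds[where z = ?z and n = n, OF z2 op _ s0 row sK sL]
      with \<open>w \<in> space (wigner_space n)\<close> show "w \<in> E n" unfolding E by simp
    qed
    \<comment> \<open>Measurability is needed for monotonicity, since the lower bound on the
      probability is known for the subset \<open>A\<close>.\<close>
    moreover have "E n \<in> sets (wigner_space n)"
      unfolding E by (rule critical_points_event_measurable)
    ultimately show "1 - \<epsilon> n \<le> measure (wigner_space n) (E n)"
      using A(2) W.finite_measure_mono by (meson order_trans)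
  qed
  moreover have "measure (wigner_space n) (E n) \<le> 1" for n
    using prob_space.prob_le_1[OF prob_space_wigner_space] .
  ultimately have "(\<lambda>n. measure (wigner_space n) (E n)) \<longlonglongrightarrow> 1"
    by (intro tendsto_sandwich[OF _ _ lim tendsto_const]) auto
  then show "(\<lambda>n. measure (wigner_space n)
       {w \<in> space (wigner_space n).
          let Y = observation (z n) (sqrt (real n) / lambda n) (wigner n w)
          in \<forall>Q. second_order_critical n Y Q \<longrightarrow>
               global_optimum n Y Q \<and> Q * Q\<^sup>T = outer (z n)})
      \<longlonglongrightarrow> 1" unfolding E_def .
qed simp

end
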